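(* Let $\{\mathsf{K}^k\}_{k=k_0}^\infty$ be a sequence of cones satisfying the embedding property with index map $I$. Then the following hold. (i) (Nested cones) Suppose a sequence of index sets $\{J_k\}_{k=k_0}^d$, with $J_k\subseteq I(d,k)\subseteq\binom{[d]}{k}$, satisfies: for every $k$ with $k_0\le k<d$ and every $s\in J_k$ there is an $s'\in J_{k+1}$ such that all the components of $s$ appear in $s'$ (this property is satisfied by $\binom{[d]}{k}$). Then $$\mathsf{K}^d_{k_0}(J_{k_0})\subseteq \mathsf{K}^d_{k_0+1}(J_{k_0+1})\subseteq\dots\subseteq \mathsf{K}^d_d(J_d).$$ In particular, if $\{I(d,k)\}_{k=k_0}^d$ is such a sequence of index sets, then for every $d\ge k_0$, $$\mathsf{K}^d_{k_0}\subseteq \mathsf{K}^d_{k_0+1}\subseteq\dots\subseteq \mathsf{K}^d_d.$$ (ii) (Dual cones) The dual cone of $\mathsf{K}^d_k(J)$ is $$(\mathsf{K}^d_k(J))^*=\{A\in\mathbb{S}^d : A \text{ is Hermitian and, for all } (i_1,\dots,i_k)\in J,\ \tau^d_{i_1\cdots i_k}(A)\in(\mathsf{K}^k)^*\}.$$ (iii) (Membership) If $I(d,k)=\binom{[d]}{k}$ for every $d$, then $$X_1\in\mathsf{K}^t_k,\ X_2\in\mathsf{K}^s_k \iff \operatorname{diag}(X_1,X_2)\in\mathsf{K}^{t+s}_k,$$ and the same holds for the dual cones: $X_1\in(\mathsf{K}^t_k)^*,\ X_2\in(\mathsf{K}^s_k)^* \iff \operatorname{diag}(X_1,X_2)\in(\mathsf{K}^{t+s}_k)^*$.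 (Here $s,t\ge k$, $X_1\in\mathbb{S}^t$, $X_2\in\mathbb{S}^s$.) (iv) (Inheritance) If the embedding property is satisfied thoroughly by $\{\mathsf{K}^k\}_{k=1}^\infty$, then for each $k\ge1$ the sequence of cones $\{\mathsf{K}^l_k\}_{l=k}^\infty$ satisfies the embedding property.
   Context: Let $\mathbb{F}$ be $\mathbb{R}$, $\mathbb{C}$, $\mathbb{H}$ (quaternions) or $\mathbb{O}$ (octonions), and let $\mathbb{S}^d=\mathbb{S}^d_{\mathbb{F}}$ be the space of $d\times d$ Hermitian matrices over $\mathbb{F}$, with the real-valued trace inner product $\langle A,B\rangle=\operatorname{tr}(AB)$ (real part of the trace when $\mathbb{F}=\mathbb{H},\mathbb{O}$). The dual of a cone $K\subseteq\mathbb{S}^d$ is $K^*=\{A\in\mathbb{S}^d:\langle A,B\rangle\ge0\ \forall B\in K\}$. $[d]=\{1,\dots,d\}$ and $\binom{[d]}{k}$ is the set of increasing sequences $(i_1<\dots<i_k)$ in $[d]$. $\operatorname{diag}(X_1,X_2)$ is the block diagonal matrix with blocks $X_1,X_2$. For $(i_1,\dots,i_k)\in\binom{[d]}{k}$, the truncation operator $\tau^d_{i_1\cdots i_k}:\mathbb{S}^d\to\mathbb{S}^k$ sends $Z=[z_{ij}]$ to its principal submatrix $[z_{i_pi_q}]_{p,q=1}^k$; the lift operator $\varepsilon^d_{i_1\cdots i_k}:\mathbb{S}^k\to\mathbb{S}^d$ sends $X$ to the matrix whose $(i_p,i_q)$ entry is $x_{pq}$ for $p,q\in[k]$ and whose other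 entries are $0$. Embedding property: let $k_0\in\mathbb{N}=\{1,2,\dots\}$ and let $\{\mathsf{K}^k: k\ge k_0\}$ be a sequence of convex proper cones with $\mathsf{K}^k\subseteq\mathbb{S}^k$, where a cone is proper if it is solid (has nonempty interior), convex, pointed and closed. Let the index map $I$ assign to each pair $d\ge k\ge k_0$ a set $I(d,k)\subseteq\binom{[d]}{k}$. The sequence satisfies the embedding property with index map $I$ if for all $d\ge k\ge k_0$ and $(i_1,\dots,i_k)\in I(d,k)$ we have $\tau^d_{i_1\cdots i_k}(Z)\in\mathsf{K}^k$ for all $Z\in\mathsf{K}^d$ and $\varepsilon^d_{i_1\cdots i_k}(X)\in\mathsf{K}^d$ for all $X\in\mathsf{K}^k$. When $I(d,k)=\binom{[d]}{k}$, reference to the index map is dropped and one just says that the sequence satisfies the embedding property; if in addition $k_0=1$, it is said to satisfy the embedding property thoroughly. Higher-order cones: for $d\ge k\ge k_0$ and $J\subseteq I(d,k)$, the $k$th order cone with index set $J$ induced by $\mathsf{K}^k$ is $\mathsf{K}^d_k(J)=\{M\in\mathbb{S}^d: M=\sum_{(i_1,\dots,i_k)\in J}\varepsilon^d_{i_1\cdots i_k}(M_{i_1\cdots i_k}),\ M_{i_1\cdots i_k}\in\mathsf{K}^k\}$, and $\mathsf{K}^d_k=\mathsf{K}^d_k(I(d,k))$.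
   Formalization: In (iv) the cones K^l_k are shown to be proper only for k ≥ 2 or l = k; for k = 1 and l ≥ 2 they consist of diagonal matrices, so are not solid, and only the truncation/lift conditions and being closed, convex and pointed are asserted. *)

theory Defs
  imports "HOL-Analysis.Analysis" "HOL-Library.Function_Algebras"
begin

section \<open>The scalars: real numbers, complex numbers, quaternions, octonions\<close>

text \<open>
  Finite-dimensional real unital algebras, not assumed associative or commutative, with a
  multiplicative Euclidean norm. By Hurwitz's theorem these are, up to isomorphism, exactly the
  real numbers, the complex numbers, the quaternions and the octonions; instances for all four
  are given below. The last two axioms determine the conjugation and the real part from the
  rest of the structure.
\<close>

class hurwitz_algebra = euclidean_space + one + times +
  fixes hconj :: "'a \<Rightarrow> 'a"
    and real_part :: "'a \<Rightarrow> real"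
  assumes hurwitz_distrib_right: "(a + b) * c = a * c + b * c"
    and hurwitz_distrib_left: "a * (b + c) = a * b + a * c"
    and hurwitz_scaleR_left: "(r *\<^sub>R a) * b = r *\<^sub>R (a * b)"
    and hurwitz_scaleR_right: "a * (r *\<^sub>R b) = r *\<^sub>R (a * b)"
    and hurwitz_one_left: "1 * a = a"
    and hurwitz_one_right: "a * 1 = a"
    and hurwitz_norm_mult: "norm (a * b) = norm a * norm b"
    and real_part_eq_inner: "real_part a = inner a 1"
    and hconj_eq: "hconj a = (2 * real_part a) *\<^sub>R 1 - a"

class hurwitz_algebra_assoc = hurwitz_algebra +
  assumes hurwitz_assoc: "(a * b) * c = a * (b * c)"

class hurwitz_algebra_comm = hurwitz_algebra_assoc +
  assumes hurwitz_comm: "a * b = b * a"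

instantiation real :: hurwitz_algebra_comm
begin

definition hconj_real :: "real \<Rightarrow> real" where "hconj_real x = x"
definition real_part_real :: "real \<Rightarrow> real" where "real_part_real x = x"

instance
proof
  fix a b c r :: real
  show "(a + b) * c = a * c + b * c" "a * (b + c) = a * b + a * c"
    by (fact distrib_right, fact distrib_left)
  show "(r *\<^sub>R a) * b = r *\<^sub>R (a * b)" "a * (r *\<^sub>R b) = r *\<^sub>R (a * b)"
    by simp_all
  show "1 * a = a" "a * 1 = a" "norm (a * b) = norm a * norm b"
    by (simp_all add: abs_mult)
  show "real_part a = inner a 1" "hconj a = (2 * real_part a) *\<^sub>R 1 - a"
    by (simp_all add: hconj_real_def real_part_real_def)
  show "(a * b) * c = a * (b * c)" "a * b = b * a"
    by (fact mult.assoc, fact mult.commute)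
qed

end

instantiation complex :: hurwitz_algebra_comm
begin

definition hconj_complex :: "complex \<Rightarrow> complex" where "hconj_complex = cnj"
definition real_part_complex :: "complex \<Rightarrow> real" where "real_part_complex = Re"

instance
proof
  fix a b c :: complex and r :: real
  show "(a + b) * c = a * c + b * c" "a * (b + c) = a * b + a * c"
    by (fact distrib_right, fact distrib_left)
  show "(r *\<^sub>R a) * b = r *\<^sub>R (a * b)" "a * (r *\<^sub>R b) = r *\<^sub>R (a * b)"
    by simp_all
  show "1 * a = a" "a * 1 = a" "norm (a * b) = norm a * norm b"
    by (simp_all add: norm_mult)
  show "real_part a = inner a 1" "hconj a = (2 * real_part a) *\<^sub>R 1 - a"
    by (simp_all add: hconj_complex_def real_part_complex_def complex_eq_iff)
  show "(a * b) * c = a * (b * c)" "a * b = b * a"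
    by (fact mult.assoc, fact mult.commute)
qed

end

lemma hurwitz_inner_polar:
  fixes x y u z :: "'a::hurwitz_algebra"
  shows "inner (x * y) (u * z) + inner (u * y) (x * z) = 2 * inner x u * inner y z"
proof -
  have n: "inner (a * b) (a * b) = inner a a * inner b b" for a b :: 'a
    using hurwitz_norm_mult[of a b]
    by (metis power_mult_distrib power2_norm_eq_inner)
  have p: "inner (a * b) (a * c) = inner a a * inner b c" for a b c :: 'a
    using n[of a "b + c"] n[of a b] n[of a c]
    by (simp add: hurwitz_distrib_left inner_add inner_commute algebra_simps)
  show ?thesis
    using p[of "x + u" y z] p[of x y z] p[of u y z]
    by (simp add: hurwitz_distrib_right inner_add inner_commute algebra_simps)
qed

lemma hurwitz_inner_left:
  fixes x y z :: "'a::hurwitz_algebra"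
  shows "inner (x * y) z = inner y (hconj x * z)"
proof -
  have diff: "(a - b) * c = a * c - b * c" for a b c :: 'a
    using hurwitz_distrib_right[of "a - b" b c] by (simp add: algebra_simps)
  show ?thesis
    using hurwitz_inner_polar[of x y 1 z]
    by (simp add: hconj_eq real_part_eq_inner diff hurwitz_scaleR_left hurwitz_one_left
        inner_diff_right)
qed

lemma hurwitz_inner_right:
  fixes x y z :: "'a::hurwitz_algebra"
  shows "inner (y * x) z = inner y (z * hconj x)"
proof -
  have diff: "c * (a - b) = c * a - c * b" for a b c :: 'a
    using hurwitz_distrib_left[of c "a - b" b] by (simp add: algebra_simps)
  have "inner (y * x) (z * 1) + inner (z * x) (y * 1) = 2 * inner y z * inner x 1"
    using hurwitz_inner_polar[of y x z 1] by simp
  thus ?thesis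
    by (simp add: hconj_eq real_part_eq_inner diff hurwitz_scaleR_right hurwitz_one_right
        inner_diff_right inner_commute[of "z * x"] inner_commute[of 1 x] algebra_simps)
qed

lemma hurwitz_norm_one [simp]: "norm (1::'a::hurwitz_algebra) = 1"
proof -
  obtain b :: 'a where "b \<in> Basis" using nonempty_Basis by blast
  hence "norm b = 1" by simp
  thus ?thesis using hurwitz_norm_mult[of 1 b] by (simp add: hurwitz_one_left)
qed

lemma hurwitz_inner_one [simp]: "inner (1::'a::hurwitz_algebra) 1 = 1"
  by (metis hurwitz_norm_one power2_norm_eq_inner one_power2)

lemma real_part_hconj [simp]: "real_part (hconj (x::'a::hurwitz_algebra)) = real_part x"
  by (simp add: hconj_eq real_part_eq_inner inner_diff_left)

lemma hconj_hconj [simp]: "hconj (hconj (x::'a::hurwitz_algebra)) = x"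
  by (simp add: hconj_eq[of "hconj x"]) (simp add: hconj_eq)

lemma hconj_add: "hconj (x + y) = hconj x + hconj (y::'a::hurwitz_algebra)"
  by (simp add: hconj_eq real_part_eq_inner inner_add_left algebra_simps)

lemma hconj_scaleR: "hconj (r *\<^sub>R x) = r *\<^sub>R hconj (x::'a::hurwitz_algebra)"
  by (simp add: hconj_eq real_part_eq_inner algebra_simps)

lemma hconj_one [simp]: "hconj (1::'a::hurwitz_algebra) = 1"
  by (simp add: hconj_eq real_part_eq_inner scaleR_2)

lemma inner_hconj_hconj: "inner (hconj x) (hconj y) = inner x (y::'a::hurwitz_algebra)"
  by (simp add: hconj_eq real_part_eq_inner inner_diff inner_commute algebra_simps)

lemma norm_hconj [simp]: "norm (hconj (x::'a::hurwitz_algebra)) = norm x"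
  by (simp add: norm_eq_sqrt_inner inner_hconj_hconj)

lemma hconj_mult: "hconj (x * y) = hconj y * hconj (x::'a::hurwitz_algebra)"
proof -
  have "inner (hconj (x * y)) z = inner (hconj y * hconj x) z" for z
    by (metis hurwitz_inner_left hurwitz_inner_right hurwitz_one_left hurwitz_one_right
        hconj_hconj inner_commute inner_hconj_hconj)
  thus ?thesis by (metis inner_commute vector_eq_rdot)
qed

lemma hurwitz_zero_left [simp]: "0 * x = (0::'a::hurwitz_algebra)"
  using hurwitz_scaleR_left[of 0 0 x] by simp

lemma hurwitz_zero_right [simp]: "x * 0 = (0::'a::hurwitz_algebra)"
  using hurwitz_scaleR_right[of x 0 0] by simp

lemma hurwitz_minus_left: "(- x) * y = - (x * (y::'a::hurwitz_algebra))"
  using hurwitz_scaleR_left[of "-1" x y] by simp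

lemma hurwitz_minus_right: "x * (- y) = - (x * (y::'a::hurwitz_algebra))"
  using hurwitz_scaleR_right[of x "-1" y] by simp

lemma hurwitz_diff_left: "(x - y) * z = x * z - y * (z::'a::hurwitz_algebra)"
  using hurwitz_distrib_right[of x "- y" z] by (simp add: hurwitz_minus_left)

lemma hurwitz_diff_right: "x * (y - z) = x * y - x * (z::'a::hurwitz_algebra)"
  using hurwitz_distrib_left[of x y "- z"] by (simp add: hurwitz_minus_right)

subsection \<open>Cayley--Dickson doubling\<close>

datatype 'a cayley_dickson = CD (cd_fst: 'a) (cd_snd: 'a)

instantiation cayley_dickson :: (real_vector) real_vector
begin

definition "0 = CD 0 0"
definition "x + y = CD (cd_fst x + cd_fst y) (cd_snd x + cd_snd y)"
definition "x - y = CD (cd_fst x - cd_fst y) (cd_snd x - cd_snd y)"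
definition "- x = CD (- cd_fst x) (- cd_snd x)"
definition "r *\<^sub>R x = CD (r *\<^sub>R cd_fst x) (r *\<^sub>R cd_snd x)"

instance
  by standard
    (auto simp: zero_cayley_dickson_def plus_cayley_dickson_def minus_cayley_dickson_def
      uminus_cayley_dickson_def scaleR_cayley_dickson_def algebra_simps)

end

lemmas cd_linear_defs = zero_cayley_dickson_def plus_cayley_dickson_def
  minus_cayley_dickson_def uminus_cayley_dickson_def scaleR_cayley_dickson_def

instantiation cayley_dickson :: (real_inner) real_inner
begin

definition "inner x y = inner (cd_fst x) (cd_fst y) + inner (cd_snd x) (cd_snd y)"
definition "norm (x::'a cayley_dickson) = sqrt (inner x x)"
definition "sgn (x::'a cayley_dickson) = x /\<^sub>R norm x"
definition "dist (x::'a cayley_dickson) y = norm (x - y)"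
definition "(uniformity :: ('a cayley_dickson \<times> 'a cayley_dickson) filter)
  = (INF e\<in>{0 <..}. principal {(x, y). dist x y < e})"
definition "open (U :: 'a cayley_dickson set)
  \<longleftrightarrow> (\<forall>x\<in>U. eventually (\<lambda>(x', y). x' = x \<longrightarrow> y \<in> U) uniformity)"

instance
proof
  fix x y z :: "'a cayley_dickson" and r :: real
  show "inner x y = inner y x"
    by (simp add: inner_cayley_dickson_def inner_commute)
  show "inner (x + y) z = inner x z + inner y z"
    by (simp add: inner_cayley_dickson_def plus_cayley_dickson_def inner_add_left)
  show "inner (r *\<^sub>R x) y = r * inner x y"
    by (simp add: inner_cayley_dickson_def scaleR_cayley_dickson_def distrib_left)
  show "0 \<le> inner x x"
    by (simp add: inner_cayley_dickson_def)
  show "inner x x = 0 \<longleftrightarrow> x = 0"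
    by (cases x) (simp add: inner_cayley_dickson_def zero_cayley_dickson_def
        add_nonneg_eq_0_iff)
qed (rule norm_cayley_dickson_def sgn_cayley_dickson_def dist_cayley_dickson_def
    uniformity_cayley_dickson_def open_cayley_dickson_def)+

end

instantiation cayley_dickson :: (euclidean_space) euclidean_space
begin

definition "Basis = (\<lambda>u. CD u 0) ` Basis \<union> (\<lambda>v. CD 0 v) ` Basis"

instance
proof
  show "(Basis :: 'a cayley_dickson set) \<noteq> {}" "finite (Basis :: 'a cayley_dickson set)"
    by (simp_all add: Basis_cayley_dickson_def)
next
  fix u v :: "'a cayley_dickson"
  assume "u \<in> Basis" "v \<in> Basis"
  thus "inner u v = (if u = v then 1 else 0)"
    by (auto simp: Basis_cayley_dickson_def inner_cayley_dickson_def inner_Basis split: if_splits)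
next
  fix x :: "'a cayley_dickson"
  show "(\<forall>u\<in>Basis. inner x u = 0) \<longleftrightarrow> x = 0"
    by (cases x) (auto simp: Basis_cayley_dickson_def inner_cayley_dickson_def
        zero_cayley_dickson_def ball_Un euclidean_all_zero_iff)
qed

end

instantiation cayley_dickson :: (hurwitz_algebra_assoc) hurwitz_algebra
begin

definition "1 = CD 1 0"
definition "x * y = CD (cd_fst x * cd_fst y - hconj (cd_snd y) * cd_snd x)
                       (cd_snd y * cd_fst x + cd_snd x * hconj (cd_fst y))"
definition "hconj x = CD (hconj (cd_fst x)) (- cd_snd x)"
definition "real_part x = real_part (cd_fst x)"

instance
proof
  fix x y z :: "'a cayley_dickson" and r :: real
  note defs = cd_linear_defs times_cayley_dickson_def one_cayley_dickson_def
  show "(x + y) * z = x * z + y * z"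
    by (simp add: defs hurwitz_distrib_left hurwitz_distrib_right)
  show "x * (y + z) = x * y + x * z"
    by (simp add: defs hurwitz_distrib_left hurwitz_distrib_right hconj_add)
  show "(r *\<^sub>R x) * y = r *\<^sub>R (x * y)"
    by (simp add: defs hurwitz_scaleR_left hurwitz_scaleR_right algebra_simps)
  show "x * (r *\<^sub>R y) = r *\<^sub>R (x * y)"
    by (simp add: defs hurwitz_scaleR_left hurwitz_scaleR_right hconj_scaleR algebra_simps)
  have h0: "hconj (0::'a) = 0"
    by (simp add: hconj_eq real_part_eq_inner)
  show "1 * x = x" "x * 1 = x"
    by (simp_all add: defs hurwitz_one_left hurwitz_one_right h0)
  show "real_part x = inner x 1"
    by (simp add: real_part_cayley_dickson_def inner_cayley_dickson_def
        one_cayley_dickson_def real_part_eq_inner)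
  show "hconj x = (2 * real_part x) *\<^sub>R 1 - x"
    by (simp add: hconj_cayley_dickson_def real_part_cayley_dickson_def defs hconj_eq)
  show "norm (x * y) = norm x * norm y"
  proof -
    obtain a b c d where xy: "x = CD a b" "y = CD c d"
      by (meson cayley_dickson.exhaust)
    have n: "inner (u * v) (u * v) = inner u u * inner v v" for u v :: 'a
      using hurwitz_norm_mult[of u v] by (metis power_mult_distrib power2_norm_eq_inner)
    have "inner (a * c) (hconj d * b) = inner (d * (a * c)) b"
      using hurwitz_inner_left[of d "a * c" b] by simp
    also have "\<dots> = inner (d * a) (b * hconj c)"
      using hurwitz_inner_right[of "d * a" c b] by (simp add: hurwitz_assoc)
    finally have "inner (a * c) (hconj d * b) = inner (d * a) (b * hconj c)" .
    hence "inner (x * y) (x * y) = inner x x * inner y y"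
      by (simp add: xy times_cayley_dickson_def inner_cayley_dickson_def inner_diff inner_add
          inner_commute n inner_hconj_hconj algebra_simps)
    thus ?thesis by (simp add: norm_cayley_dickson_def real_sqrt_mult)
  qed
qed

end

instance cayley_dickson :: (hurwitz_algebra_comm) hurwitz_algebra_assoc
proof
  fix x y z :: "'a cayley_dickson"
  have lc: "a * (b * c) = b * (a * c)" for a b c :: 'a
    by (metis hurwitz_assoc hurwitz_comm)
  have diff: "hconj (a - b) = hconj a - hconj b" for a b :: 'a
    by (simp add: hconj_eq real_part_eq_inner inner_diff_left algebra_simps)
  show "(x * y) * z = x * (y * z)"
    by (simp add: times_cayley_dickson_def hconj_mult hconj_add diff hurwitz_distrib_left
        hurwitz_distrib_right hurwitz_diff_left hurwitz_diff_right)
       (simp add: hurwitz_assoc hurwitz_comm lc)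
qed

type_synonym quaternion = "complex cayley_dickson"
type_synonym octonion = "quaternion cayley_dickson"

lemma "OFCLASS(quaternion, hurwitz_algebra_class)"
  by standard

lemma "OFCLASS(octonion, hurwitz_algebra_class)"
  by standard

section \<open>Hermitian matrices\<close>

text \<open>
  A \<open>d \<times> d\<close> matrix is a function of two indices below \<open>d\<close>, extended by zero; indices start
  at 0, so that \<open>{..<d}\<close> stands for \<open>[d]\<close>. The product topology on functions induces the
  Euclidean topology on the finite-dimensional space of these matrices.
\<close>

type_synonym 'a sqmat = "nat \<Rightarrow> nat \<Rightarrow> 'a"

instantiation "fun" :: (type, real_vector) real_vector
begin

definition "r *\<^sub>R f = (\<lambda>x. r *\<^sub>R f x)"

instance
  by standard (simp_all add: scaleR_fun_def fun_eq_iff algebra_simps)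

end

definition hermitian :: "nat \<Rightarrow> 'a::hurwitz_algebra sqmat set" where
  "hermitian d = {A. (\<forall>i<d. \<forall>j<d. A i j = hconj (A j i)) \<and>
                     (\<forall>i j. \<not> (i < d \<and> j < d) \<longrightarrow> A i j = 0)}"

definition mat_prod :: "nat \<Rightarrow> 'a::hurwitz_algebra sqmat \<Rightarrow> 'a sqmat \<Rightarrow> 'a sqmat" where
  "mat_prod d A B = (\<lambda>i j. \<Sum>k<d. A i k * B k j)"

definition mat_trace :: "nat \<Rightarrow> 'a::hurwitz_algebra sqmat \<Rightarrow> 'a" where
  "mat_trace d A = (\<Sum>i<d. A i i)"

definition trace_inner :: "nat \<Rightarrow> 'a::hurwitz_algebra sqmat \<Rightarrow> 'a sqmat \<Rightarrow> real" where
  "trace_inner d A B = real_part (mat_trace d (mat_prod d A B))"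

definition block_diag ::
    "nat \<Rightarrow> nat \<Rightarrow> 'a::hurwitz_algebra sqmat \<Rightarrow> 'a sqmat \<Rightarrow> 'a sqmat" where
  "block_diag t s X1 X2 = (\<lambda>i j.
     if i < t \<and> j < t then X1 i j
     else if t \<le> i \<and> i < t + s \<and> t \<le> j \<and> j < t + s then X2 (i - t) (j - t)
     else 0)"

section \<open>Cones of Hermitian matrices\<close>

definition dual_cone :: "nat \<Rightarrow> 'a::hurwitz_algebra sqmat set \<Rightarrow> 'a sqmat set" where
  "dual_cone d K = {A \<in> hermitian d. \<forall>B\<in>K. 0 \<le> trace_inner d A B}"

definition pointed :: "'a::real_vector set \<Rightarrow> bool" where
  "pointed K \<longleftrightarrow> K \<inter> uminus ` K = {0}"

definition solid :: "nat \<Rightarrow> 'a::hurwitz_algebra sqmat set \<Rightarrow> bool" where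
  "solid d K \<longleftrightarrow> (top_of_set (hermitian d)) interior_of K \<noteq> {}"

definition closed_pointed_cone :: "nat \<Rightarrow> 'a::hurwitz_algebra sqmat set \<Rightarrow> bool" where
  "closed_pointed_cone d K \<longleftrightarrow>
     K \<subseteq> hermitian d \<and> cone K \<and> convex K \<and> pointed K \<and> closedin (top_of_set (hermitian d)) K"

definition proper_cone :: "nat \<Rightarrow> 'a::hurwitz_algebra sqmat set \<Rightarrow> bool" where
  "proper_cone d K \<longleftrightarrow> closed_pointed_cone d K \<and> solid d K"

section \<open>Truncations, lifts and higher-order cones\<close>

definition incr_seqs :: "nat \<Rightarrow> nat \<Rightarrow> nat list set" where
  "incr_seqs d k = {is. length is = k \<and> sorted_wrt (<) is \<and> set is \<subseteq> {..<d}}"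

definition truncation :: "nat list \<Rightarrow> 'a::hurwitz_algebra sqmat \<Rightarrow> 'a sqmat" where
  "truncation is Z = (\<lambda>p q. if p < length is \<and> q < length is then Z (is ! p) (is ! q) else 0)"

text \<open>At most one summand is nonzero, because the entries of \<open>is\<close> are distinct.\<close>

definition lift_mat :: "nat list \<Rightarrow> 'a::hurwitz_algebra sqmat \<Rightarrow> 'a sqmat" where
  "lift_mat is X = (\<lambda>i j. \<Sum>p<length is. \<Sum>q<length is.
     if i = is ! p \<and> j = is ! q then X p q else 0)"

lemma lift_mat_nth:
  assumes "distinct is" "p < length is" "q < length is"
  shows "lift_mat is X (is ! p) (is ! q) = X p q"
proof -
  have "lift_mat is X (is ! p) (is ! q) =
      (\<Sum>p'<length is. \<Sum>q'<length is. if q' = q then (if p' = p then X p' q' else 0) else 0)"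
    unfolding lift_mat_def using assms
    by (intro sum.cong refl) (auto simp: nth_eq_iff_index_eq)
  thus ?thesis using assms by simp
qed

lemma lift_mat_outside:
  "\<not> (i \<in> set is \<and> j \<in> set is) \<Longrightarrow> lift_mat is X i j = 0"
  unfolding lift_mat_def by (intro sum.neutral ballI) auto

definition embedding_property ::
    "nat \<Rightarrow> (nat \<Rightarrow> nat \<Rightarrow> nat list set) \<Rightarrow> (nat \<Rightarrow> 'a::hurwitz_algebra sqmat set) \<Rightarrow> bool" where
  "embedding_property k0 I K \<longleftrightarrow>
     (\<forall>d k. k0 \<le> k \<and> k \<le> d \<longrightarrow> (\<forall>is\<in>I d k.
        (\<forall>Z\<in>K d. truncation is Z \<in> K k) \<and> (\<forall>X\<in>K k. lift_mat is X \<in> K d)))"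

definition embedding_property_thoroughly ::
    "(nat \<Rightarrow> 'a::hurwitz_algebra sqmat set) \<Rightarrow> bool" where
  "embedding_property_thoroughly K \<longleftrightarrow> embedding_property 1 incr_seqs K"

text \<open>The order \<open>k\<close> enters only through the cone \<open>Kk\<close> of \<open>k \<times> k\<close> matrices.\<close>

definition higher_order_cone ::
    "nat \<Rightarrow> 'a::hurwitz_algebra sqmat set \<Rightarrow> nat list set \<Rightarrow> 'a sqmat set" where
  "higher_order_cone d Kk J =
     {M \<in> hermitian d. \<exists>X. (\<forall>is\<in>J. X is \<in> Kk) \<and> M = (\<Sum>is\<in>J. lift_mat is (X is))}"

definition nested_index_sets :: "nat \<Rightarrow> nat \<Rightarrow> (nat \<Rightarrow> nat list set) \<Rightarrow> bool" where
  "nested_index_sets k0 d J \<longleftrightarrow>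
     (\<forall>k. k0 \<le> k \<and> k < d \<longrightarrow> (\<forall>s\<in>J k. \<exists>s'\<in>J (Suc k). set s \<subseteq> set s'))"

end

theory Submission
  imports Defs
begin

text \<open>
  A higher-order cone is the convex cone generated by the lifts of the members of a small cone
  \<open>C\<close> (\<open>lift_in_higher_order_cone\<close>, \<open>higher_order_cone_minimal\<close>). A claim about all its members
  that is stable under sums therefore needs a proof for single lifts only, and each of the four
  parts comes down to one fact about a lift.

  Nesting: a matrix supported on an index set \<open>u\<close> is recovered by truncating to any \<open>u'\<close> that
  contains \<open>u\<close> and lifting back. If \<open>X\<close> lies in the cone of order \<open>k\<close>, its lift lies in the cone
  of order \<open>d\<close>, and the truncation of the latter to \<open>u'\<close> lies in the cone of order \<open>k + 1\<close>. The
  detour through order \<open>d\<close> uses the embedding property exactly at the index sets that are given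
  (\<open>higher_order_cone_nested\<close>).

  Dual cones: truncation is adjoint to lifting for the trace inner product
  (\<open>trace_inner_lift\<close>), so pairing with all lifts means pairing all truncations with \<open>C\<close>.

  Membership and the embedding property of the inherited cones: lifts compose with lifts
  (\<open>lift_higher_order_cone\<close>), and a truncation of a lift is again a lift of a member of \<open>C\<close>
  (\<open>truncation_higher_order_cone\<close>). A block diagonal matrix is the sum of the lifts of its two
  blocks, and the blocks are its truncations.

  It remains to see that the inherited cones are proper. Pointedness holds because they lie inside
  the given cone of the same size. Closedness rests on a compactness argument: the sum of two
  closed cones is closed unless they contain opposite nonzero vectors (\<open>closed_cone_sum\<close>).
  Interior points arise as sums of lifted interior points, since for \<open>k \<ge> 2\<close> every matrix entry
  lies in some principal submatrix of size \<open>k\<close> (\<open>solid_higher_order_cone\<close>).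
\<close>

section \<open>Index sequences\<close>

lemma incr_seqsD:
  assumes "u \<in> incr_seqs d k"
  shows "length u = k" "distinct u" "set u \<subseteq> {..<d}" "sorted_wrt (<) u"
  using assms by (auto simp: incr_seqs_def strict_sorted_iff)

lemma incr_seqs_nth_less: "u \<in> incr_seqs d k \<Longrightarrow> p < k \<Longrightarrow> u ! p < d"
  using incr_seqsD(1,3)[of u d k] by (metis lessThan_iff nth_mem subsetD)

lemma finite_incr_seqs: "finite (incr_seqs d k)"
  by (rule finite_subset[OF _ finite_lists_length_eq[of "{..<d}" k]])
     (auto simp: incr_seqs_def)

lemma sorted_list_of_set_in_incr_seqs:
  assumes "P \<subseteq> {..<d}"
  shows "sorted_list_of_set P \<in> incr_seqs d (card P)"
  using assms finite_subset[OF assms] by (simp add: incr_seqs_def)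

lemma incr_seqs_superset:
  assumes "P \<subseteq> {..<d}" "card P \<le> k" "k \<le> d"
  obtains u where "u \<in> incr_seqs d k" "P \<subseteq> set u"
proof -
  obtain Q where Q: "P \<subseteq> Q" "Q \<subseteq> {..<d}" "card Q = k"
    using exists_subset_between[of P k "{..<d}"] assms by auto
  have "finite Q" using Q(2) by (rule finite_subset) simp
  thus thesis
    using that[of "sorted_list_of_set Q"] sorted_list_of_set_in_incr_seqs[OF Q(2)] Q by simp
qed

lemma incr_seqs_compose:
  assumes "u \<in> incr_seqs d m" "r \<in> incr_seqs m k"
  shows "map ((!) u) r \<in> incr_seqs d k"
proof -
  note u = incr_seqsD[OF assms(1)] and r = incr_seqsD[OF assms(2)]
  have "sorted_wrt (<) (map ((!) u) r)"
    unfolding sorted_wrt_map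
    by (rule sorted_wrt_mono_rel[OF _ r(4)])
       (use u r in \<open>auto simp: sorted_wrt_iff_nth_less\<close>)
  moreover have "set (map ((!) u) r) \<subseteq> {..<d}"
    using incr_seqs_nth_less[OF assms(1)] r(3) by auto
  ultimately show ?thesis using r(1) by (simp add: incr_seqs_def)
qed

lemma upt_in_incr_seqs: "a + n \<le> d \<Longrightarrow> [a..<a + n] \<in> incr_seqs d n"
  by (auto simp: incr_seqs_def)

lemma incr_seqs_full: "incr_seqs k k = {[0..<k]}"
proof -
  have "u = [0..<k]" if u: "u \<in> incr_seqs k k" for u
  proof -
    note u = incr_seqsD[OF u]
    have "set u = {..<k}"
      by (rule card_subset_eq[OF _ u(3)]) (use distinct_card[OF u(2)] u(1) in simp_all)
    hence "set u = set [0..<k]" by (simp only: atLeast_upt)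
    thus ?thesis using u(4) by (metis strict_sorted_equal sorted_wrt_upt)
  qed
  moreover have "[0..<k] \<in> incr_seqs k k" using upt_in_incr_seqs[of 0 k k] by simp
  ultimately show ?thesis by blast
qed

lemma sum_eq_sum_nth:
  fixes f :: "nat \<Rightarrow> 'b::comm_monoid_add"
  assumes "u \<in> incr_seqs d k" "\<And>i. i \<notin> set u \<Longrightarrow> f i = 0"
  shows "(\<Sum>i<d. f i) = (\<Sum>p<k. f (u ! p))"
proof -
  note u = incr_seqsD[OF assms(1)]
  have "(\<Sum>i<d. f i) = (\<Sum>i\<in>set u. f i)"
    by (rule sum.mono_neutral_right) (use u assms(2) in auto)
  also have "\<dots> = (\<Sum>p<k. f (u ! p))"
    by (rule sum.reindex_bij_betw[symmetric]) (use bij_betw_nth[OF u(2)] u(1) in auto)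
  finally show ?thesis .
qed

section \<open>Truncations and lifts\<close>

lemma sqmat_scaleR_apply [simp]: "(c *\<^sub>R X) i j = c *\<^sub>R X i j"
  for X :: "'a::real_vector sqmat"
  by (simp add: scaleR_fun_def)

lemma sqmat_sum_apply: "(\<Sum>s\<in>S. F s) i j = (\<Sum>s\<in>S. F s i j)"
  for F :: "'s \<Rightarrow> 'a::comm_monoid_add sqmat"
  by (induction S rule: infinite_finite_induct) auto

lemma hconj_zero [simp]: "hconj (0::'a::hurwitz_algebra) = 0"
  by (simp add: hconj_eq real_part_eq_inner)

lemma hermitian_outside: "A \<in> hermitian d \<Longrightarrow> \<not> (i < d \<and> j < d) \<Longrightarrow> A i j = 0"
  unfolding hermitian_def by blast

text \<open>Outside the \<open>d \<times> d\<close> block the symmetry holds trivially, so the index bounds on it can be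
  dropped; oriented from right to left, it is also a terminating rewrite rule.\<close>

lemma hermitian_iff:
  "A \<in> hermitian d \<longleftrightarrow>
    (\<forall>i j. hconj (A j i) = A i j) \<and> (\<forall>i j. \<not> (i < d \<and> j < d) \<longrightarrow> A i j = 0)"
proof
  assume A: "A \<in> hermitian d"
  have "hconj (A j i) = A i j" for i j
  proof (cases "i < d \<and> j < d")
    case True
    hence "A i j = hconj (A j i)" using A unfolding hermitian_def by blast
    thus ?thesis by (rule sym)
  next
    case False
    thus ?thesis using hermitian_outside[OF A, of i j] hermitian_outside[OF A, of j i] by auto
  qed
  thus "(\<forall>i j. hconj (A j i) = A i j) \<and> (\<forall>i j. \<not> (i < d \<and> j < d) \<longrightarrow> A i j = 0)"
    using hermitian_outside[OF A] by blast
next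
  assume "(\<forall>i j. hconj (A j i) = A i j) \<and> (\<forall>i j. \<not> (i < d \<and> j < d) \<longrightarrow> A i j = 0)"
  hence "\<forall>i j. A i j = hconj (A j i)" "\<forall>i j. \<not> (i < d \<and> j < d) \<longrightarrow> A i j = 0"
    by (metis, blast)
  thus "A \<in> hermitian d" unfolding hermitian_def by blast
qed

lemma hermitian_hconj: "A \<in> hermitian d \<Longrightarrow> hconj (A j i) = A i j"
  by (simp add: hermitian_iff)

lemma convex_cone_hermitian: "convex_cone (hermitian d)"
  by (simp add: convex_cone_iff hermitian_iff hconj_add hconj_scaleR)

text \<open>This characterisation by entries replaces the double sum in the definition of a lift.\<close>

lemma lift_mat_eqI:
  assumes "distinct u"
    and "\<And>p q. p < length u \<Longrightarrow> q < length u \<Longrightarrow> M (u ! p) (u ! q) = X p q"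
    and "\<And>i j. \<not> (i \<in> set u \<and> j \<in> set u) \<Longrightarrow> M i j = 0"
  shows "lift_mat u X = M"
proof (intro ext)
  fix i j
  show "lift_mat u X i j = M i j"
    by (cases "i \<in> set u \<and> j \<in> set u")
       (auto simp: in_set_conv_nth lift_mat_nth assms lift_mat_outside)
qed

lemma lift_truncation_apply:
  assumes "distinct u"
  shows "lift_mat u (truncation u M) i j = (if i \<in> set u \<and> j \<in> set u then M i j else 0)"
proof -
  have "lift_mat u (truncation u M) = (\<lambda>i j. if i \<in> set u \<and> j \<in> set u then M i j else 0)"
    by (rule lift_mat_eqI[OF assms]) (auto simp: truncation_def)
  thus ?thesis by simp
qed

lemma lift_truncation:
  assumes "distinct u" "\<And>i j. \<not> (i \<in> set u \<and> j \<in> set u) \<Longrightarrow> M i j = 0"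
  shows "lift_mat u (truncation u M) = M"
  using assms(2) by (auto simp: fun_eq_iff lift_truncation_apply[OF assms(1)])

lemma truncation_lift:
  assumes "distinct u" "X \<in> hermitian (length u)"
  shows "truncation u (lift_mat u X) = X"
  using assms by (auto simp: truncation_def fun_eq_iff lift_mat_nth hermitian_outside)

lemma lift_lift:
  assumes "distinct u" "distinct r" "set r \<subseteq> {..<length u}"
  shows "lift_mat u (lift_mat r X) = lift_mat (map ((!) u) r) X"
proof (rule lift_mat_eqI[OF assms(1)])
  have inj: "inj_on ((!) u) (set r)"
    using assms(1,3) by (intro inj_on_nth) auto
  have dist: "distinct (map ((!) u) r)"
    using assms(2) inj by (simp add: distinct_map)
  have mem: "u ! p \<in> set (map ((!) u) r) \<longleftrightarrow> p \<in> set r" if "p < length u" for p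
    using that assms by (auto simp: image_iff nth_eq_iff_index_eq subset_iff)
  show "lift_mat (map ((!) u) r) X (u ! p) (u ! q) = lift_mat r X p q"
    if pq: "p < length u" "q < length u" for p q
  proof (cases "p \<in> set r \<and> q \<in> set r")
    case True
    then obtain a b where "a < length r" "p = r ! a" "b < length r" "q = r ! b"
      by (auto simp: in_set_conv_nth)
    thus ?thesis
      using lift_mat_nth[OF dist, of a b X] lift_mat_nth[OF assms(2), of a b X] by simp
  next
    case False
    thus ?thesis using mem pq by (simp add: lift_mat_outside)
  qed
  have "set (map ((!) u) r) \<subseteq> set u" using assms(3) by auto
  thus "lift_mat (map ((!) u) r) X i j = 0" if "\<not> (i \<in> set u \<and> j \<in> set u)" for i j
    using that by (intro lift_mat_outside) blast
qed

lemma truncation_truncation: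
  assumes "set r \<subseteq> {..<length u}"
  shows "truncation r (truncation u Z) = truncation (map ((!) u) r) Z"
  using assms by (force simp: truncation_def fun_eq_iff subset_iff)

lemma truncation_zero [simp]: "truncation u 0 = 0"
  by (simp add: truncation_def fun_eq_iff)

lemma truncation_add: "truncation u (X + Y) = truncation u X + truncation u Y"
  by (simp add: truncation_def fun_eq_iff)

lemma lift_zero [simp]: "lift_mat u 0 = 0"
  by (auto simp: lift_mat_def fun_eq_iff intro!: sum.neutral)

lemma lift_add: "lift_mat u (X + Y) = lift_mat u X + lift_mat u Y"
  by (auto simp: lift_mat_def fun_eq_iff sum.distrib[symmetric] intro!: sum.cong)

lemma lift_scaleR: "lift_mat u (c *\<^sub>R X) = c *\<^sub>R lift_mat u X"
  by (auto simp: lift_mat_def fun_eq_iff scaleR_sum_right intro!: sum.cong)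

lemma truncation_hermitian:
  assumes "Z \<in> hermitian d"
  shows "truncation u Z \<in> hermitian (length u)"
  using hermitian_hconj[OF assms] by (simp add: truncation_def hermitian_iff)

lemma lift_hermitian:
  assumes "u \<in> incr_seqs d k" "X \<in> hermitian k"
  shows "lift_mat u X \<in> hermitian d"
proof -
  note u = incr_seqsD[OF assms(1)]
  have "hconj (lift_mat u X j i) = lift_mat u X i j" for i j
  proof (cases "i \<in> set u \<and> j \<in> set u")
    case True
    thus ?thesis using hermitian_hconj[OF assms(2)] u by (auto simp: in_set_conv_nth lift_mat_nth)
  qed (auto simp: lift_mat_outside)
  moreover have "lift_mat u X i j = 0" if "\<not> (i < d \<and> j < d)" for i j
    using that u(3) by (intro lift_mat_outside) auto
  ultimately show ?thesis unfolding hermitian_iff by blast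
qed

text \<open>This reduces block diagonal matrices to lifts, so that no index arithmetic with blocks is
  needed in the membership results.\<close>

lemma block_diag_eq_lift:
  "block_diag t s X1 X2 = lift_mat [0..<t] X1 + lift_mat [t..<t + s] X2"
proof (intro ext)
  fix i j
  have 1: "lift_mat [0..<t] X1 = (\<lambda>i j. if i < t \<and> j < t then X1 i j else 0)"
    by (rule lift_mat_eqI) auto
  have 2: "lift_mat [t..<t + s] X2 = (\<lambda>i j. if t \<le> i \<and> i < t + s \<and> t \<le> j \<and> j < t + s
      then X2 (i - t) (j - t) else 0)"
    by (rule lift_mat_eqI) auto
  show "block_diag t s X1 X2 i j = (lift_mat [0..<t] X1 + lift_mat [t..<t + s] X2) i j"
    unfolding 1 2 block_diag_def by auto
qed

lemma truncation_block_diag_fst: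
  "X1 \<in> hermitian t \<Longrightarrow> truncation [0..<t] (block_diag t s X1 X2) = X1"
  by (auto simp: truncation_def block_diag_def fun_eq_iff hermitian_outside)

lemma truncation_block_diag_snd:
  "X2 \<in> hermitian s \<Longrightarrow> truncation [t..<t + s] (block_diag t s X1 X2) = X2"
  by (auto simp: truncation_def block_diag_def fun_eq_iff hermitian_outside)

lemma block_diag_hermitian:
  assumes "X1 \<in> hermitian t" "X2 \<in> hermitian s"
  shows "block_diag t s X1 X2 \<in> hermitian (t + s)"
proof -
  have "lift_mat [0..<t] X1 \<in> hermitian (t + s)" "lift_mat [t..<t + s] X2 \<in> hermitian (t + s)"
    using lift_hermitian[OF _ assms(1)] lift_hermitian[OF _ assms(2)]
      upt_in_incr_seqs[of 0 t "t + s"] upt_in_incr_seqs[of t s "t + s"] by simp_all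
  thus ?thesis using convex_cone_hermitian unfolding block_diag_eq_lift convex_cone_iff by blast
qed

section \<open>The trace inner product\<close>

lemma trace_inner_eq: "trace_inner d A B = (\<Sum>i<d. \<Sum>j<d. inner (A i j * B j i) 1)"
  by (simp add: trace_inner_def mat_trace_def mat_prod_def real_part_eq_inner inner_sum_left)

lemma trace_inner_add_right: "trace_inner d A (B + C) = trace_inner d A B + trace_inner d A C"
  by (simp add: trace_inner_eq hurwitz_distrib_left inner_add_left sum.distrib)

lemma trace_inner_zero_right [simp]: "trace_inner d A 0 = 0"
  by (simp add: trace_inner_eq)

text \<open>The real part of a product of two scalars does not depend on their order, in the octonions
  too; products of three scalars never arise.\<close>

lemma trace_inner_commute: "trace_inner d A B = trace_inner d B A"
proof -
  have "inner (a * b) 1 = inner (b * a) 1" for a b :: 'a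
    using hurwitz_inner_left[of a b 1] hurwitz_inner_right[of b a 1]
    by (simp add: hurwitz_one_left hurwitz_one_right)
  hence "trace_inner d A B = (\<Sum>i<d. \<Sum>j<d. inner (B j i * A i j) 1)"
    unfolding trace_inner_eq by simp
  also have "\<dots> = trace_inner d B A"
    unfolding trace_inner_eq by (rule sum.swap)
  finally show ?thesis .
qed

text \<open>Truncation is adjoint to lifting, because only the entries of \<open>A\<close> on the index set meet
  nonzero entries of the lift.\<close>

lemma trace_inner_lift:
  assumes "u \<in> incr_seqs d k"
  shows "trace_inner d A (lift_mat u X) = trace_inner k (truncation u A) X"
proof -
  note u = incr_seqsD[OF assms]
  have "trace_inner d A (lift_mat u X) =
      (\<Sum>p<k. \<Sum>j<d. inner (A (u ! p) j * lift_mat u X j (u ! p)) 1)"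
    unfolding trace_inner_eq by (rule sum_eq_sum_nth[OF assms]) (simp add: lift_mat_outside)
  also have "\<dots> = (\<Sum>p<k. \<Sum>q<k. inner (A (u ! p) (u ! q) * lift_mat u X (u ! q) (u ! p)) 1)"
    by (intro sum.cong refl sum_eq_sum_nth[OF assms]) (simp add: lift_mat_outside)
  also have "\<dots> = trace_inner k (truncation u A) X"
    unfolding trace_inner_eq
    by (intro sum.cong refl) (use u in \<open>simp add: truncation_def lift_mat_nth\<close>)
  finally show ?thesis .
qed

lemma dual_cone_iff:
  "A \<in> dual_cone d C \<longleftrightarrow> A \<in> hermitian d \<and> (\<forall>B\<in>C. 0 \<le> trace_inner d A B)"
  by (simp add: dual_cone_def)

section \<open>Higher-order cones\<close>

lemma closed_pointed_coneD:
  assumes "closed_pointed_cone d C"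
  shows "C \<subseteq> hermitian d" "convex_cone C" "\<And>X. X \<in> C \<Longrightarrow> - X \<in> C \<Longrightarrow> X = 0"
proof -
  have p: "C \<inter> uminus ` C = {0}" and cc: "convex C \<and> cone C"
    using assms by (auto simp: closed_pointed_cone_def pointed_def)
  show "C \<subseteq> hermitian d" using assms by (simp add: closed_pointed_cone_def)
  have "0 \<in> C" using p by blast
  thus "convex_cone C" using cc[unfolded convex_cone] by (simp add: convex_cone_iff)
  show "X = 0" if "X \<in> C" "- X \<in> C" for X
    using p that by (metis Int_iff imageI minus_minus singletonD)
qed

lemma convex_cone_sum: "convex_cone C \<Longrightarrow> (\<And>s. s \<in> S \<Longrightarrow> f s \<in> C) \<Longrightarrow> sum f S \<in> C"
  by (induction S rule: infinite_finite_induct) (auto simp: convex_cone_iff)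

text \<open>A higher-order cone is the convex cone generated by the lifts. Minimality is stated with
  the two closure properties that finite sums need, so that it applies to half-spaces and to
  preimages under truncations and lifts alike.\<close>

lemma higher_order_cone_minimal:
  assumes "M \<in> higher_order_cone d C J"
    and "0 \<in> D" "\<And>X Y. X \<in> D \<Longrightarrow> Y \<in> D \<Longrightarrow> X + Y \<in> D"
    and "\<And>u X. u \<in> J \<Longrightarrow> X \<in> C \<Longrightarrow> lift_mat u X \<in> D"
  shows "M \<in> D"
proof -
  obtain X where X: "\<And>u. u \<in> J \<Longrightarrow> X u \<in> C" "M = (\<Sum>u\<in>J. lift_mat u (X u))"
    using assms(1) by (auto simp: higher_order_cone_def)
  have "(\<Sum>u\<in>S. lift_mat u (X u)) \<in> D" if "S \<subseteq> J" for S
    using that by (induction S rule: infinite_finite_induct) (auto simp: assms(2-4) X(1))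
  thus ?thesis using X(2) by blast
qed

context
  fixes d k :: nat and J :: "nat list set" and C :: "'a::hurwitz_algebra sqmat set"
  assumes J: "J \<subseteq> incr_seqs d k" and C: "C \<subseteq> hermitian k" "convex_cone C"
begin

lemma higher_order_cone_iff:
  "M \<in> higher_order_cone d C J \<longleftrightarrow> (\<exists>X. (\<forall>u\<in>J. X u \<in> C) \<and> M = (\<Sum>u\<in>J. lift_mat u (X u)))"
proof -
  have "(\<Sum>u\<in>J. lift_mat u (X u)) \<in> hermitian d" if "\<forall>u\<in>J. X u \<in> C" for X
    by (rule convex_cone_sum[OF convex_cone_hermitian], rule lift_hermitian)
       (use that J C in auto)
  thus ?thesis by (auto simp: higher_order_cone_def)
qed

lemma convex_cone_higher_order_cone: "convex_cone (higher_order_cone d C J)"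
  unfolding convex_cone_iff
proof (intro conjI ballI allI impI)
  show "0 \<in> higher_order_cone d C J"
    unfolding higher_order_cone_iff
    using C(2) by (intro exI[of _ "\<lambda>_. 0"]) (simp add: convex_cone_iff)
next
  fix M N assume "M \<in> higher_order_cone d C J" "N \<in> higher_order_cone d C J"
  then obtain X Y where "\<forall>u\<in>J. X u \<in> C" "M = (\<Sum>u\<in>J. lift_mat u (X u))"
    "\<forall>u\<in>J. Y u \<in> C" "N = (\<Sum>u\<in>J. lift_mat u (Y u))"
    unfolding higher_order_cone_iff by blast
  thus "M + N \<in> higher_order_cone d C J"
    unfolding higher_order_cone_iff
    using C(2) by (intro exI[of _ "\<lambda>u. X u + Y u"]) (simp add: convex_cone_iff lift_add sum.distrib)
next
  fix M and c :: real assume "M \<in> higher_order_cone d C J" "0 \<le> c"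
  then obtain X where "\<forall>u\<in>J. X u \<in> C" "M = (\<Sum>u\<in>J. lift_mat u (X u))"
    unfolding higher_order_cone_iff by blast
  thus "c *\<^sub>R M \<in> higher_order_cone d C J"
    unfolding higher_order_cone_iff
    using C(2) \<open>0 \<le> c\<close> by (intro exI[of _ "\<lambda>u. c *\<^sub>R X u"])
      (simp add: convex_cone_iff lift_scaleR scaleR_sum_right)
qed

lemma lift_in_higher_order_cone:
  assumes "u \<in> J" "X \<in> C"
  shows "lift_mat u X \<in> higher_order_cone d C J"
proof -
  have "finite J" using J finite_incr_seqs by (rule finite_subset)
  hence "lift_mat u X = (\<Sum>v\<in>J. lift_mat v (if v = u then X else 0))"
    using assms(1) by (simp add: if_distrib[of "lift_mat _"] sum.delta' cong: if_cong)
  thus ?thesis unfolding higher_order_cone_iff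
    using assms C(2) by (intro exI[of _ "\<lambda>v. if v = u then X else 0"]) (simp add: convex_cone_iff)
qed

text \<open>By adjointness, a matrix is nonnegative on every lift exactly if its truncations are
  nonnegative on \<open>C\<close>; a linear functional that is nonnegative on the generators is so on the
  whole cone.\<close>

lemma dual_higher_order_cone:
  "dual_cone d (higher_order_cone d C J) =
    {A \<in> hermitian d. \<forall>u\<in>J. truncation u A \<in> dual_cone k C}"
proof (intro equalityI subsetI)
  fix A assume A: "A \<in> dual_cone d (higher_order_cone d C J)"
  have "0 \<le> trace_inner k (truncation u A) X" if "u \<in> J" "X \<in> C" for u X
    using A lift_in_higher_order_cone[OF that] trace_inner_lift[OF subsetD[OF J that(1)], of A X]
    by (auto simp: dual_cone_iff)
  moreover have "truncation u A \<in> hermitian k" if "u \<in> J" for u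
    using truncation_hermitian[of A d u] A incr_seqsD(1)[of u d k] J that by (auto simp: dual_cone_iff)
  ultimately show "A \<in> {A \<in> hermitian d. \<forall>u\<in>J. truncation u A \<in> dual_cone k C}"
    using A by (auto simp: dual_cone_iff)
next
  fix A assume A: "A \<in> {A \<in> hermitian d. \<forall>u\<in>J. truncation u A \<in> dual_cone k C}"
  have "M \<in> {M. 0 \<le> trace_inner d A M}" if "M \<in> higher_order_cone d C J" for M
    by (rule higher_order_cone_minimal[OF that])
       (use A J in \<open>auto simp: trace_inner_add_right trace_inner_lift dual_cone_iff\<close>)
  thus "A \<in> dual_cone d (higher_order_cone d C J)" using A by (simp add: dual_cone_iff)
qed

end

section \<open>Truncating and lifting higher-order cones\<close>

text \<open>It suffices to truncate a single lift \<open>lift_mat v X\<close>. The overlap of \<open>v\<close> with \<open>u\<close>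
  may have fewer than \<open>k\<close> indices, and no cone of that order need be given. The overlap is
  therefore filled up with arbitrary further members of \<open>u\<close> to a \<open>k\<close>-element index set \<open>w\<close>.
  Since the lift vanishes on the added indices, cutting down to \<open>u\<close> equals cutting down to \<open>w\<close>
  and lifting back into the positions of \<open>w\<close> within \<open>u\<close>. The embedding property enters as
  \<open>stable\<close>, which keeps the matrix of size \<open>k\<close> obtained in between inside \<open>C\<close>.\<close>

lemma truncation_higher_order_cone:
  assumes u: "u \<in> incr_seqs d m" and "k \<le> m"
    and C: "C \<subseteq> hermitian k" "convex_cone C"
    and stable: "\<And>v w X. v \<in> incr_seqs d k \<Longrightarrow> w \<in> incr_seqs d k \<Longrightarrow> X \<in> C \<Longrightarrow>
      truncation w (lift_mat v X) \<in> C"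
    and M: "M \<in> higher_order_cone d C (incr_seqs d k)"
  shows "truncation u M \<in> higher_order_cone m C (incr_seqs m k)"
proof -
  let ?H = "higher_order_cone m C (incr_seqs m k)"
  have cone: "convex_cone ?H" by (rule convex_cone_higher_order_cone[OF order_refl C])
  note u' = incr_seqsD[OF u]
  have "truncation u (lift_mat v X) \<in> ?H" if v: "v \<in> incr_seqs d k" and X: "X \<in> C" for v X
  proof -
    note v' = incr_seqsD[OF v]
    \<comment> \<open>Positions in \<open>u\<close> rather than indices, because the result has size \<open>m\<close>.\<close>
    define Q where "Q = {p. p < m \<and> u ! p \<in> set v}"
    have "card Q \<le> card (set v)"
      by (rule card_inj_on_le[of "(!) u"])
         (use u' in \<open>auto simp: Q_def inj_on_def nth_eq_iff_index_eq\<close>)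
    hence "card Q \<le> k" using v' by (simp add: distinct_card)
    then obtain r where r: "r \<in> incr_seqs m k" "Q \<subseteq> set r"
      using incr_seqs_superset[of Q m k] \<open>k \<le> m\<close> by (auto simp: Q_def)
    note r' = incr_seqsD[OF r(1)]
    define w where "w = map ((!) u) r"
    have w: "w \<in> incr_seqs d k" unfolding w_def by (rule incr_seqs_compose[OF u r(1)])
    have "truncation u (lift_mat v X) i j = 0" if "\<not> (i \<in> set r \<and> j \<in> set r)" for i j
      using that r(2) u' by (auto simp: truncation_def Q_def intro!: lift_mat_outside)
    hence "truncation u (lift_mat v X) = lift_mat r (truncation r (truncation u (lift_mat v X)))"
      using lift_truncation[OF r'(2)] by metis
    also have "\<dots> = lift_mat r (truncation w (lift_mat v X))"
      using r'(3) u'(1) by (simp add: w_def truncation_truncation)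
    also have "\<dots> \<in> ?H"
      by (rule lift_in_higher_order_cone[OF order_refl C r(1) stable[OF v w X]])
    finally show ?thesis .
  qed
  hence "M \<in> {M. truncation u M \<in> ?H}"
    using cone by (intro higher_order_cone_minimal[OF M]) (auto simp: truncation_add convex_cone_iff)
  thus ?thesis by simp
qed

lemma lift_higher_order_cone:
  assumes u: "u \<in> incr_seqs d m" and C: "C \<subseteq> hermitian k" "convex_cone C"
    and M: "M \<in> higher_order_cone m C (incr_seqs m k)"
  shows "lift_mat u M \<in> higher_order_cone d C (incr_seqs d k)"
proof -
  let ?H = "higher_order_cone d C (incr_seqs d k)"
  have cone: "convex_cone ?H" by (rule convex_cone_higher_order_cone[OF order_refl C])
  have "lift_mat u (lift_mat r X) \<in> ?H" if r: "r \<in> incr_seqs m k" and X: "X \<in> C" for r X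
    using lift_lift[of u r X] incr_seqsD[OF u] incr_seqsD[OF r]
      lift_in_higher_order_cone[OF order_refl C incr_seqs_compose[OF u r] X] by simp
  hence "M \<in> {M. lift_mat u M \<in> ?H}"
    using cone by (intro higher_order_cone_minimal[OF M]) (auto simp: lift_add convex_cone_iff)
  thus ?thesis by simp
qed

section \<open>Topology of matrix spaces\<close>

lemma tendsto_sqmat_iff:
  fixes f :: "'b \<Rightarrow> 'a::topological_space sqmat"
  shows "(f \<longlongrightarrow> L) F \<longleftrightarrow> (\<forall>i j. ((\<lambda>n. f n i j) \<longlongrightarrow> L i j) F)"
proof -
  have "(g \<longlongrightarrow> h) F \<longleftrightarrow> (\<forall>i. ((\<lambda>n. g n i) \<longlongrightarrow> h i) F)"
    for g :: "'b \<Rightarrow> nat \<Rightarrow> 'c::topological_space" and h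
    using limitin_componentwise[of "\<lambda>_. euclidean" UNIV g h F]
    by (simp add: euclidean_product_topology)
  thus ?thesis by metis
qed

lemma closed_limit:
  fixes S :: "'a::first_countable_topology set"
  shows "closed S \<Longrightarrow> (\<And>n. x n \<in> S) \<Longrightarrow> x \<longlonglongrightarrow> L \<Longrightarrow> L \<in> S"
  unfolding closed_sequential_limits by blast

lemma closed_hermitian: "closed (hermitian d :: 'a::hurwitz_algebra sqmat set)"
  unfolding closed_sequential_limits
proof (intro allI impI)
  fix x :: "nat \<Rightarrow> 'a sqmat" and L
  assume "(\<forall>n. x n \<in> hermitian d) \<and> x \<longlonglongrightarrow> L"
  hence x: "\<And>n. x n \<in> hermitian d" and L: "\<And>i j. (\<lambda>n. x n i j) \<longlonglongrightarrow> L i j"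
    by (simp_all add: tendsto_sqmat_iff)
  have "hconj (L j i) = L i j" for i j
  proof (rule LIMSEQ_unique[OF _ L])
    have "(\<lambda>n. hconj (x n j i)) \<longlonglongrightarrow> hconj (L j i)"
      unfolding hconj_eq real_part_eq_inner by (intro tendsto_intros L)
    thus "(\<lambda>n. x n i j) \<longlonglongrightarrow> hconj (L j i)" using hermitian_hconj[OF x] by simp
  qed
  moreover have "L i j = 0" if "\<not> (i < d \<and> j < d)" for i j
    using L[of i j] hermitian_outside[OF x that] by (simp add: LIMSEQ_const_iff)
  ultimately show "L \<in> hermitian d" unfolding hermitian_iff by blast
qed

text \<open>Truncation is a continuous left inverse of lifting.\<close>

lemma closed_lift_image:
  assumes u: "u \<in> incr_seqs d k" and C: "closed C" "C \<subseteq> hermitian k"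
  shows "closed (lift_mat u ` C)"
  unfolding closed_sequential_limits
proof (intro allI impI)
  fix x L
  assume "(\<forall>n. x n \<in> lift_mat u ` C) \<and> x \<longlonglongrightarrow> L"
  then obtain X where X: "\<And>n. X n \<in> C" "x = (\<lambda>n. lift_mat u (X n))" and "x \<longlonglongrightarrow> L"
    by (auto simp: image_iff fun_eq_iff) metis
  hence L: "\<And>i j. (\<lambda>n. lift_mat u (X n) i j) \<longlonglongrightarrow> L i j" by (simp add: tendsto_sqmat_iff)
  note u' = incr_seqsD[OF u]
  have "X n = truncation u (lift_mat u (X n))" for n
    using truncation_lift[OF u'(2), of "X n"] X(1)[of n] C(2) u'(1) by auto
  moreover have "(\<lambda>n. truncation u (lift_mat u (X n))) \<longlonglongrightarrow> truncation u L"
    unfolding tendsto_sqmat_iff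
  proof (intro allI)
    show "(\<lambda>n. truncation u (lift_mat u (X n)) i j) \<longlonglongrightarrow> truncation u L i j" for i j
      using L by (cases "i < length u \<and> j < length u") (auto simp: truncation_def)
  qed
  ultimately have "X \<longlonglongrightarrow> truncation u L" by simp
  hence "truncation u L \<in> C" by (rule closed_limit[OF C(1) X(1)])
  moreover have "lift_mat u (truncation u L) = L"
  proof (rule lift_truncation[OF u'(2)])
    show "L i j = 0" if "\<not> (i \<in> set u \<and> j \<in> set u)" for i j
      using L[of i j] that by (simp add: lift_mat_outside LIMSEQ_const_iff)
  qed
  ultimately show "L \<in> lift_mat u ` C" by (metis image_eqI)
qed

text \<open>Tychonoff's theorem stands in for the compactness of bounded closed sets in a Euclidean
  space.\<close>

lemma compact_sqmat_box:
  fixes d :: nat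
  shows "compact {X :: 'a::euclidean_space sqmat.
    \<forall>i j. X i j \<in> (if i < d \<and> j < d then cball 0 1 else {0})}" (is "compact ?B")
proof -
  have c: "compactin euclidean (PiE UNIV (S :: nat \<Rightarrow> 'c set))"
    if "\<And>i. compactin euclidean (S i)" for S :: "nat \<Rightarrow> 'c::topological_space set"
    using that compactin_PiE[of "\<lambda>_. euclidean" UNIV S] by (simp add: euclidean_product_topology)
  have "compactin euclidean
      (PiE UNIV (\<lambda>i. PiE UNIV (\<lambda>j. if i < d \<and> j < d then cball 0 1 else {0::'a})))"
    by (intro c) simp
  moreover have "PiE UNIV (\<lambda>i. PiE UNIV (\<lambda>j. if i < d \<and> j < d then cball 0 1 else {0})) = ?B"
    by (simp add: PiE_UNIV_domain Pi_def)
  ultimately show ?thesis by simp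
qed

text \<open>Sums \<open>X n + Y n\<close> may converge although the summands run off to infinity. Scaling
  by \<open>c n = 1 / (1 + size (X n))\<close> brings the first summand into a compact set; along a
  subsequence everything converges. If the limit of \<open>c\<close> is positive, it can be divided
  out; if it is zero, the scaled sums tend to zero and the limit of the scaled first summands
  is a nonzero member of \<open>A\<close> whose negative lies in \<open>B\<close>, which the last hypothesis excludes.\<close>

lemma closed_cone_sum:
  fixes A B :: "'a::hurwitz_algebra sqmat set"
  assumes "closed A" "closed B" "convex_cone A" "convex_cone B" "A \<subseteq> hermitian d"
    and pointed: "\<And>X. X \<in> A \<Longrightarrow> - X \<in> B \<Longrightarrow> X = 0"
  shows "closed {X + Y |X Y. X \<in> A \<and> Y \<in> B}"
  unfolding closed_sequential_limits
proof (intro allI impI)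
  fix M L assume M: "(\<forall>n. M n \<in> {X + Y |X Y. X \<in> A \<and> Y \<in> B}) \<and> M \<longlonglongrightarrow> L"
  hence "\<forall>n. \<exists>X Y. X \<in> A \<and> Y \<in> B \<and> M n = X + Y" by blast
  then obtain X Y where X: "\<And>n. X n \<in> A" and Y: "\<And>n. Y n \<in> B" and MXY: "\<And>n. M n = X n + Y n"
    by metis
  have L: "(\<lambda>n. M n i j) \<longlonglongrightarrow> L i j" for i j
    using M by (simp add: tendsto_sqmat_iff)
  define size where "size Z = (\<Sum>i<d. \<Sum>j<d. norm (Z i j))" for Z :: "'a sqmat"
  have size_nonneg: "0 \<le> size Z" for Z
    unfolding size_def by (intro sum_nonneg norm_ge_zero)
  have size_scaleR: "size (c *\<^sub>R Z) = c * size Z" if "0 \<le> c" for c Z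
    using that by (simp add: size_def sum_distrib_left)
  have norm_le_size: "norm (Z i j) \<le> size Z" if "i < d" "j < d" for Z i j
  proof -
    have "norm (Z i j) \<le> (\<Sum>j<d. norm (Z i j))"
      using that by (intro member_le_sum) auto
    also have "\<dots> \<le> size Z"
      unfolding size_def using that
      by (intro member_le_sum[of i "{..<d}" "\<lambda>i. \<Sum>j<d. norm (Z i j)"] sum_nonneg) auto
    finally show ?thesis .
  qed
  define c where "c n = 1 / (1 + size (X n))" for n
  have c: "0 < c n" "c n \<le> 1" for n
    using size_nonneg[of "X n"] by (auto simp: c_def)
  have size_scaled: "size (c n *\<^sub>R X n) = 1 - c n" for n
    using size_nonneg[of "X n"] c(1)[of n] by (simp add: size_scaleR c_def field_simps)
  define Box where "Box = {X :: 'a sqmat. \<forall>i j. X i j \<in> (if i < d \<and> j < d then cball 0 1 else {0})}"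
  have "c n *\<^sub>R X n \<in> Box" for n
  proof -
    have "norm ((c n *\<^sub>R X n) i j) \<le> 1" if "i < d" "j < d" for i j
      using norm_le_size[OF that, of "c n *\<^sub>R X n"] c(1)[of n] unfolding size_scaled by linarith
    moreover have "X n \<in> hermitian d" using X assms(5) by blast
    ultimately show ?thesis by (auto simp: Box_def hermitian_outside)
  qed
  hence mem: "\<forall>n. (c n, c n *\<^sub>R X n) \<in> {0..1} \<times> Box" using c by (auto intro: less_imp_le)
  have compact: "seq_compact ({0..1::real} \<times> Box)"
    using compact_sqmat_box[of d, where 'a='a]
    by (intro compact_imp_seq_compact compact_Times) (simp_all add: Box_def)
  obtain l and r :: "nat \<Rightarrow> nat" where "strict_mono r"
    and l: "((\<lambda>n. (c n, c n *\<^sub>R X n)) \<circ> r) \<longlonglongrightarrow> l"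
    by (rule seq_compactE[OF compact mem])
  define e a where "e = fst l" and "a = snd l"
  have e: "(\<lambda>n. c (r n)) \<longlonglongrightarrow> e"
    using tendsto_fst[OF l] by (simp add: e_def o_def)
  have a: "(\<lambda>n. c (r n) *\<^sub>R X (r n)) \<longlonglongrightarrow> a"
    using tendsto_snd[OF l] by (simp add: a_def o_def)
  have a_entries: "(\<lambda>n. c (r n) *\<^sub>R X (r n) i j) \<longlonglongrightarrow> a i j" for i j
    using a by (simp add: tendsto_sqmat_iff)
  have "a \<in> A"
    using X c assms(3) by (intro closed_limit[OF assms(1) _ a]) (simp add: convex_cone_iff less_imp_le)
  have L': "(\<lambda>n. M (r n) i j) \<longlonglongrightarrow> L i j" for i j
    using LIMSEQ_subseq_LIMSEQ[OF L[of i j] \<open>strict_mono r\<close>] by (simp add: o_def)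
  have "(\<lambda>n. c (r n) *\<^sub>R M (r n) i j - c (r n) *\<^sub>R X (r n) i j) \<longlonglongrightarrow> e *\<^sub>R L i j - a i j" for i j
    by (intro tendsto_intros e L' a_entries)
  hence b: "(\<lambda>n. c (r n) *\<^sub>R Y (r n)) \<longlonglongrightarrow> e *\<^sub>R L - a"
    by (simp add: tendsto_sqmat_iff MXY scaleR_add_right)
  have "e *\<^sub>R L - a \<in> B"
    using Y c assms(4) by (intro closed_limit[OF assms(2) _ b]) (simp add: convex_cone_iff less_imp_le)
  have "0 \<le> e" by (rule LIMSEQ_le_const[OF e]) (intro exI allI impI less_imp_le c(1))
  have "(\<lambda>n. 1 - c (r n)) \<longlonglongrightarrow> size a"
    unfolding size_scaled[symmetric] unfolding size_def
    by (intro tendsto_intros) (simp add: a_entries)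
  moreover have "(\<lambda>n. 1 - c (r n)) \<longlonglongrightarrow> 1 - e" by (intro tendsto_intros e)
  ultimately have size_a: "size a = 1 - e" by (rule LIMSEQ_unique)
  have "e \<noteq> 0"
  proof
    assume "e = 0"
    hence "a = 0" using pointed[OF \<open>a \<in> A\<close>] \<open>e *\<^sub>R L - a \<in> B\<close> by simp
    thus False using size_a \<open>e = 0\<close> by (simp add: size_def)
  qed
  hence "(1 / e) *\<^sub>R a \<in> A" "(1 / e) *\<^sub>R (e *\<^sub>R L - a) \<in> B"
    using assms(3,4) \<open>a \<in> A\<close> \<open>e *\<^sub>R L - a \<in> B\<close> \<open>0 \<le> e\<close> by (simp_all add: convex_cone_iff)
  moreover have "L = (1 / e) *\<^sub>R a + (1 / e) *\<^sub>R (e *\<^sub>R L - a)"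
    using \<open>e \<noteq> 0\<close> by (simp add: fun_eq_iff scaleR_diff_right)
  ultimately show "L \<in> {X + Y |X Y. X \<in> A \<and> Y \<in> B}" by blast
qed

text \<open>Adding the lifted cones one at a time keeps the sum closed, because all of them lie in
  one pointed cone \<open>D\<close>, so that the hypothesis on opposite vectors persists.\<close>

lemma closed_higher_order_cone:
  assumes J: "J \<subseteq> incr_seqs d k" and C: "C \<subseteq> hermitian k" "convex_cone C" "closed C"
    and D: "convex_cone D" "\<And>X. X \<in> D \<Longrightarrow> - X \<in> D \<Longrightarrow> X = 0"
    and lifts: "\<And>u X. u \<in> J \<Longrightarrow> X \<in> C \<Longrightarrow> lift_mat u X \<in> D"
  shows "closed (higher_order_cone d C J)"
proof -
  have "finite J" using J finite_incr_seqs by (rule finite_subset)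
  thus ?thesis using J lifts
  proof (induction J rule: finite_induct)
    case empty
    have "higher_order_cone d C {} = {0 :: 'a sqmat}"
      by (auto simp: higher_order_cone_iff[OF _ C(1,2)])
    moreover have "closed {0 :: 'a sqmat}"
      unfolding closed_sequential_limits
      by (auto simp: tendsto_sqmat_iff fun_eq_iff LIMSEQ_const_iff)
    ultimately show ?case by simp
  next
    case (insert u S)
    let ?H = "higher_order_cone d C"
    have S: "S \<subseteq> incr_seqs d k" and u: "u \<in> incr_seqs d k" using insert.prems by auto
    note cone = convex_cone_higher_order_cone[OF insert.prems(1) C(1,2)]
    have "?H (insert u S) = {X + Y |X Y. X \<in> lift_mat u ` C \<and> Y \<in> ?H S}"
    proof (intro equalityI subsetI)
      fix M assume "M \<in> ?H (insert u S)"
      then obtain X where "\<forall>v\<in>insert u S. X v \<in> C" "M = (\<Sum>v\<in>insert u S. lift_mat v (X v))"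
        using higher_order_cone_iff[OF insert.prems(1) C(1,2)] by blast
      moreover from this have "(\<Sum>v\<in>S. lift_mat v (X v)) \<in> ?H S"
        unfolding higher_order_cone_iff[OF S C(1,2)] by blast
      ultimately show "M \<in> {X + Y |X Y. X \<in> lift_mat u ` C \<and> Y \<in> ?H S}"
        using insert.hyps by auto
    next
      fix M assume "M \<in> {X + Y |X Y. X \<in> lift_mat u ` C \<and> Y \<in> ?H S}"
      then obtain X Y where M: "M = lift_mat u X + Y" "X \<in> C" "Y \<in> ?H S" by blast
      have "Y \<in> ?H (insert u S)"
        using cone lift_in_higher_order_cone[OF insert.prems(1) C(1,2)]
        by (intro higher_order_cone_minimal[OF M(3)]) (auto simp: convex_cone_iff)
      moreover have "lift_mat u X \<in> ?H (insert u S)"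
        using lift_in_higher_order_cone[OF insert.prems(1) C(1,2) _ M(2)] by blast
      ultimately show "M \<in> ?H (insert u S)" using cone M(1) by (simp add: convex_cone_iff)
    qed
    moreover have "closed {X + Y |X Y. X \<in> lift_mat u ` C \<and> Y \<in> ?H S}"
    proof (rule closed_cone_sum)
      show "closed (lift_mat u ` C)" by (rule closed_lift_image[OF u C(3,1)])
      show "closed (?H S)" using insert.IH[OF S] insert.prems(2) by blast
      show "convex_cone (lift_mat u ` C)"
        using C(2) image_eqI[of 0 "lift_mat u" 0 C] unfolding convex_cone_iff
        by (auto simp: lift_add[symmetric] lift_scaleR[symmetric])
      show "convex_cone (?H S)" by (rule convex_cone_higher_order_cone[OF S C(1,2)])
      show "lift_mat u ` C \<subseteq> hermitian d" using lift_hermitian[OF u] C(1) by auto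
      have sub: "Y \<in> D" if "Y \<in> ?H S" for Y
        using D(1) insert.prems(2)
        by (intro higher_order_cone_minimal[OF that]) (auto simp: convex_cone_iff)
      show "X = 0" if "X \<in> lift_mat u ` C" "- X \<in> ?H S" for X
        using that sub insert.prems(2) by (intro D(2)) auto
    qed
    ultimately show ?case by simp
  qed
qed

text \<open>The product topology controls finitely many entries only, but a Hermitian matrix of size
  \<open>d\<close> has no others. Without a norm on the function type, the radius comes from a sequence of
  counterexamples that converges entrywise to the interior point.\<close>

lemma solid_iff_box:
  fixes C :: "'a::hurwitz_algebra sqmat set"
  shows "solid d C \<longleftrightarrow> (\<exists>X\<in>hermitian d. \<exists>e>0. \<forall>Y\<in>hermitian d.
    (\<forall>i<d. \<forall>j<d. norm (Y i j - X i j) < e) \<longrightarrow> Y \<in> C)"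
proof
  assume "solid d C"
  then obtain X U where U: "open U" "X \<in> hermitian d \<inter> U" "hermitian d \<inter> U \<subseteq> C"
    unfolding solid_def interior_of_def openin_open by blast
  show "\<exists>X\<in>hermitian d. \<exists>e>0. \<forall>Y\<in>hermitian d.
    (\<forall>i<d. \<forall>j<d. norm (Y i j - X i j) < e) \<longrightarrow> Y \<in> C"
  proof (rule ccontr)
    assume "\<not> ?thesis"
    hence "\<exists>Y\<in>hermitian d. (\<forall>i<d. \<forall>j<d. norm (Y i j - X i j) < 1 / real (Suc n)) \<and> Y \<notin> C" for n
      using U(2) by (metis IntD1 of_nat_0_less_iff zero_less_Suc zero_less_divide_1_iff)
    then obtain Y where Y: "\<And>n. Y n \<in> hermitian d"
      "\<And>n i j. i < d \<Longrightarrow> j < d \<Longrightarrow> norm (Y n i j - X i j) < 1 / real (Suc n)" "\<And>n. Y n \<notin> C"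
      by metis
    have "(\<lambda>n. Y n i j) \<longlonglongrightarrow> X i j" for i j
    proof (cases "i < d \<and> j < d")
      case True
      have "(\<lambda>n. Y n i j - X i j) \<longlonglongrightarrow> 0"
        by (rule Lim_null_comparison[OF _ lim_1_over_n[THEN LIMSEQ_Suc]])
           (use Y(2) True in \<open>auto intro!: always_eventually less_imp_le\<close>)
      thus ?thesis by (simp add: LIM_zero_iff)
    next
      case False
      thus ?thesis using hermitian_outside[OF Y(1)] hermitian_outside[of X d i j] U(2) by simp
    qed
    hence "Y \<longlonglongrightarrow> X" by (simp add: tendsto_sqmat_iff)
    hence "eventually (\<lambda>n. Y n \<in> U) sequentially" using topological_tendstoD U(1,2) by blast
    then obtain n where "Y n \<in> U" by (auto simp: eventually_sequentially)
    thus False using Y(1,3) U(3) by blast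
  qed
next
  assume "\<exists>X\<in>hermitian d. \<exists>e>0. \<forall>Y\<in>hermitian d.
    (\<forall>i<d. \<forall>j<d. norm (Y i j - X i j) < e) \<longrightarrow> Y \<in> C"
  then obtain X e where X: "X \<in> hermitian d" "e > 0"
    "\<And>Y. Y \<in> hermitian d \<Longrightarrow> (\<And>i j. i < d \<Longrightarrow> j < d \<Longrightarrow> norm (Y i j - X i j) < e) \<Longrightarrow> Y \<in> C"
    by metis
  define U where "U = {Y :: 'a sqmat. \<forall>i\<in>{..<d}. \<forall>j\<in>{..<d}. norm (Y i j - X i j) < e}"
  have cont: "continuous_on UNIV (\<lambda>Y :: 'a sqmat. Y i j)" for i j
    by (rule continuous_on_product_then_coordinatewise, rule continuous_on_product_coordinates)
  have "U = (\<Inter>i\<in>{..<d}. \<Inter>j\<in>{..<d}. {Y. norm (Y i j - X i j) < e})"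
    by (auto simp: U_def)
  hence "open U"
    by (auto intro!: open_INT open_Collect_less continuous_intros cont)
  hence "openin (top_of_set (hermitian d)) (hermitian d \<inter> U)" by auto
  moreover have "hermitian d \<inter> U \<subseteq> C" using X(3) by (auto simp: U_def)
  moreover have "X \<in> hermitian d \<inter> U" using X(1,2) by (auto simp: U_def)
  ultimately show "solid d C" unfolding solid_def using interior_of_maximal by blast
qed

text \<open>An interior point of \<open>C\<close> yields one of the higher-order cone, namely the sum of its
  lifts. A small perturbation of that sum is spread over the index sequences by giving
  each of them an equal share of the perturbation of every entry that it covers. For this, every
  pair of indices must be covered, which is where \<open>k\<close> has to be at least 2: for \<open>k = 1\<close> only
  diagonal matrices are obtained.\<close>

lemma solid_higher_order_cone:
  fixes C :: "'a::hurwitz_algebra sqmat set"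
  assumes "2 \<le> k" "k \<le> d" and C: "C \<subseteq> hermitian k" "convex_cone C" and "solid k C"
  shows "solid d (higher_order_cone d C (incr_seqs d k))"
proof -
  let ?J = "incr_seqs d k"
  obtain X e where X: "X \<in> hermitian k" "e > 0" and ball:
    "\<And>Y. Y \<in> hermitian k \<Longrightarrow> (\<And>i j. i < k \<Longrightarrow> j < k \<Longrightarrow> norm (Y i j - X i j) < e) \<Longrightarrow> Y \<in> C"
    using assms(5) unfolding solid_iff_box by metis
  define P where "P = (\<Sum>u\<in>?J. lift_mat u X)"
  have P: "P \<in> hermitian d"
    unfolding P_def by (intro convex_cone_sum[OF convex_cone_hermitian] lift_hermitian[OF _ X(1)])
  define N where "N i j = card {u \<in> ?J. i \<in> set u \<and> j \<in> set u}" for i j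
  have N_commute: "N i j = N j i" for i j
    unfolding N_def by (rule arg_cong[of _ _ card]) auto
  have N_pos: "1 \<le> N i j" if ij: "i < d" "j < d" for i j
  proof -
    have card: "card {i, j} \<le> k" using assms(1) card_insert_le_m1[of 2 "{j}" i] by simp
    obtain u where "u \<in> ?J" "{i, j} \<subseteq> set u"
      by (rule incr_seqs_superset[of "{i, j}" d k]) (use card assms(2) ij in auto)
    hence "{u \<in> ?J. i \<in> set u \<and> j \<in> set u} \<noteq> {}" by auto
    thus ?thesis
      unfolding N_def using finite_incr_seqs[of d k] by (simp add: Suc_le_eq card_gt_0_iff)
  qed
  have "Y \<in> higher_order_cone d C ?J"
    if Y: "Y \<in> hermitian d" and near: "\<And>i j. i < d \<Longrightarrow> j < d \<Longrightarrow> norm (Y i j - P i j) < e" for Y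
  proof -
    \<comment> \<open>\<open>N i j\<close> index sequences share the perturbation of the entry \<open>(i, j)\<close>.\<close>
    define W where "W = (\<lambda>i j. (1 / N i j) *\<^sub>R (Y i j - P i j))"
    have hconj_diff: "hconj (a - b) = hconj a - hconj b" for a b :: 'a
      using hconj_add[of "a - b" b] by simp
    have W: "W \<in> hermitian d"
      using Y P N_commute by (simp add: hermitian_iff W_def hconj_scaleR hconj_diff)
    have small: "norm (W i j) < e" if "i < d" "j < d" for i j
    proof -
      have "norm (W i j) = norm (Y i j - P i j) / N i j" by (simp add: W_def)
      also have "\<dots> \<le> norm (Y i j - P i j)"
        using N_pos[OF that] mult_left_mono[of 1 "real (N i j)" "norm (Y i j - P i j)"]
        by (simp add: divide_le_eq)
      finally show ?thesis using near[OF that] by simp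
    qed
    have in_C: "X + truncation u W \<in> C" if u: "u \<in> ?J" for u
    proof (rule ball)
      note u' = incr_seqsD[OF u]
      show "X + truncation u W \<in> hermitian k"
        using convex_cone_add[OF convex_cone_hermitian X(1)] truncation_hermitian[OF W, of u] u'(1)
        by simp
      show "norm ((X + truncation u W) i j - X i j) < e" if "i < k" "j < k" for i j
        using that u'(1) small incr_seqs_nth_less[OF u] by (simp add: truncation_def)
    qed
    have "(\<Sum>u\<in>?J. lift_mat u (truncation u W)) i j = (Y - P) i j" for i j
    proof -
      have "(\<Sum>u\<in>?J. lift_mat u (truncation u W)) i j =
          (\<Sum>u\<in>?J. if i \<in> set u \<and> j \<in> set u then W i j else 0)"
        unfolding sqmat_sum_apply
        by (intro sum.cong refl) (simp add: lift_truncation_apply incr_seqsD(2))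
      also have "\<dots> = (\<Sum>u\<in>{u \<in> ?J. i \<in> set u \<and> j \<in> set u}. W i j)"
        by (rule sum.inter_filter[symmetric]) (rule finite_incr_seqs)
      also have "\<dots> = N i j *\<^sub>R W i j" by (simp add: N_def sum_constant_scaleR)
      also have "\<dots> = (Y - P) i j"
      proof (cases "i < d \<and> j < d")
        case True
        thus ?thesis using N_pos[of i j] by (simp add: W_def)
      next
        case False
        thus ?thesis using hermitian_outside[OF Y] hermitian_outside[OF P] by (simp add: W_def)
      qed
      finally show ?thesis .
    qed
    hence "(\<Sum>u\<in>?J. lift_mat u (truncation u W)) = Y - P" by (intro ext)
    hence "Y = P + (\<Sum>u\<in>?J. lift_mat u (truncation u W))" by simp
    also have "\<dots> = (\<Sum>u\<in>?J. lift_mat u (X + truncation u W))"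
      by (simp add: P_def lift_add sum.distrib)
    finally have "Y = (\<Sum>u\<in>?J. lift_mat u (X + truncation u W))" .
    thus ?thesis
      unfolding higher_order_cone_iff[OF order_refl C]
      by (intro exI[of _ "\<lambda>u. X + truncation u W"]) (simp add: in_C)
  qed
  thus ?thesis unfolding solid_iff_box using P X(2) by blast
qed

section \<open>The four properties\<close>

text \<open>A lift to \<open>u\<close> vanishes outside every \<open>u'\<close> containing \<open>u\<close>, so it is the lift of its own
  truncation to \<open>u'\<close>.\<close>

lemma higher_order_cone_nested:
  assumes J: "J \<subseteq> incr_seqs d k" "J' \<subseteq> incr_seqs d k'"
    and C': "C' \<subseteq> hermitian k'" "convex_cone C'"
    and cover: "\<And>u. u \<in> J \<Longrightarrow> \<exists>u'\<in>J'. set u \<subseteq> set u'"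
    and stable: "\<And>u u' X. u \<in> J \<Longrightarrow> u' \<in> J' \<Longrightarrow> X \<in> C \<Longrightarrow> truncation u' (lift_mat u X) \<in> C'"
  shows "higher_order_cone d C J \<subseteq> higher_order_cone d C' J'"
proof
  fix M assume M: "M \<in> higher_order_cone d C J"
  note cone = convex_cone_higher_order_cone[OF J(2) C']
  have "lift_mat u X \<in> higher_order_cone d C' J'" if u: "u \<in> J" and X: "X \<in> C" for u X
  proof -
    obtain u' where u': "u' \<in> J'" "set u \<subseteq> set u'" using cover[OF u] by blast
    have "lift_mat u' (truncation u' (lift_mat u X)) = lift_mat u X"
      by (rule lift_truncation) (use u' J(2) incr_seqsD(2) lift_mat_outside in blast)+
    thus ?thesis
      using lift_in_higher_order_cone[OF J(2) C' u'(1) stable[OF u u'(1) X]] by simp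
  qed
  thus "M \<in> higher_order_cone d C' J'"
    using cone by (intro higher_order_cone_minimal[OF M]) (auto simp: convex_cone_iff)
qed

lemma nested_index_sets_incr_seqs: "nested_index_sets k0 d (incr_seqs d)"
  unfolding nested_index_sets_def
proof (intro allI impI ballI)
  fix k s assume k: "k0 \<le> k \<and> k < d" and s: "s \<in> incr_seqs d k"
  obtain u where "u \<in> incr_seqs d (Suc k)" "set s \<subseteq> set u"
    by (rule incr_seqs_superset[of "set s" d "Suc k"])
       (use k incr_seqsD[OF s] in \<open>auto simp: distinct_card\<close>)
  thus "\<exists>s'\<in>incr_seqs d (Suc k). set s \<subseteq> set s'" by blast
qed

context
  fixes k t s :: nat and C :: "'a::hurwitz_algebra sqmat set" and X1 X2 :: "'a sqmat"
  assumes C: "C \<subseteq> hermitian k" "convex_cone C"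
    and stable: "\<And>v w X. v \<in> incr_seqs (t + s) k \<Longrightarrow> w \<in> incr_seqs (t + s) k \<Longrightarrow> X \<in> C \<Longrightarrow>
      truncation w (lift_mat v X) \<in> C"
    and kts: "k \<le> t" "k \<le> s"
    and X: "X1 \<in> hermitian t" "X2 \<in> hermitian s"
begin

private abbreviation (input) H where "H n \<equiv> higher_order_cone n C (incr_seqs n k)"

private lemma blocks: "[0..<t] \<in> incr_seqs (t + s) t" "[t..<t + s] \<in> incr_seqs (t + s) s"
  using upt_in_incr_seqs[of 0 t "t + s"] upt_in_incr_seqs[of t s "t + s"] by simp_all

lemma block_diag_in_higher_order_cone_iff:
  "X1 \<in> H t \<and> X2 \<in> H s \<longleftrightarrow> block_diag t s X1 X2 \<in> H (t + s)"
proof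
  assume "X1 \<in> H t \<and> X2 \<in> H s"
  thus "block_diag t s X1 X2 \<in> H (t + s)"
    using lift_higher_order_cone[OF blocks(1) C] lift_higher_order_cone[OF blocks(2) C]
      convex_cone_higher_order_cone[OF order_refl C, of "t + s"]
    unfolding block_diag_eq_lift convex_cone_iff by blast
next
  assume D: "block_diag t s X1 X2 \<in> H (t + s)"
  show "X1 \<in> H t \<and> X2 \<in> H s"
    using truncation_higher_order_cone[OF blocks(1) kts(1) C stable D]
      truncation_higher_order_cone[OF blocks(2) kts(2) C stable D]
    by (simp add: truncation_block_diag_fst truncation_block_diag_snd X)
qed

text \<open>The pairing with a block diagonal matrix sees only the two diagonal blocks of the other
  factor, and truncation maps the cone of size \<open>t + s\<close> into the cones of size \<open>t\<close> and \<open>s\<close>.\<close>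

lemma block_diag_in_dual_iff:
  "X1 \<in> dual_cone t (H t) \<and> X2 \<in> dual_cone s (H s) \<longleftrightarrow>
    block_diag t s X1 X2 \<in> dual_cone (t + s) (H (t + s))"
proof
  assume D: "X1 \<in> dual_cone t (H t) \<and> X2 \<in> dual_cone s (H s)"
  have "0 \<le> trace_inner (t + s) (block_diag t s X1 X2) M" if M: "M \<in> H (t + s)" for M
  proof -
    have "trace_inner (t + s) (block_diag t s X1 X2) M =
        trace_inner t X1 (truncation [0..<t] M) + trace_inner s X2 (truncation [t..<t + s] M)"
      using trace_inner_lift[OF blocks(1), of M X1] trace_inner_lift[OF blocks(2), of M X2]
      by (simp add: block_diag_eq_lift trace_inner_add_right trace_inner_commute[of _ _ M]
          trace_inner_commute[of _ X1] trace_inner_commute[of _ X2])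
    moreover have "truncation [0..<t] M \<in> H t" "truncation [t..<t + s] M \<in> H s"
      using truncation_higher_order_cone[OF blocks(1) kts(1) C stable M]
        truncation_higher_order_cone[OF blocks(2) kts(2) C stable M] by simp_all
    ultimately show ?thesis using D by (simp add: dual_cone_iff)
  qed
  thus "block_diag t s X1 X2 \<in> dual_cone (t + s) (H (t + s))"
    using block_diag_hermitian[OF X] by (simp add: dual_cone_iff)
next
  assume D: "block_diag t s X1 X2 \<in> dual_cone (t + s) (H (t + s))"
  have "0 \<le> trace_inner t X1 M" if "M \<in> H t" for M
    using bspec[OF D[unfolded dual_cone_iff, THEN conjunct2] lift_higher_order_cone[OF blocks(1) C that]]
    by (simp add: trace_inner_lift[OF blocks(1)] truncation_block_diag_fst X)
  moreover have "0 \<le> trace_inner s X2 M" if "M \<in> H s" for M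
    using bspec[OF D[unfolded dual_cone_iff, THEN conjunct2] lift_higher_order_cone[OF blocks(2) C that]]
    by (simp add: trace_inner_lift[OF blocks(2)] truncation_block_diag_snd X)
  ultimately show "X1 \<in> dual_cone t (H t) \<and> X2 \<in> dual_cone s (H s)"
    using X by (simp add: dual_cone_iff)
qed

end

text \<open>The ambient cone \<open>D\<close> contains the higher-order cone and passes its pointedness on to it.\<close>

lemma closed_pointed_higher_order_cone:
  assumes J: "J \<subseteq> incr_seqs d k" and C: "closed_pointed_cone k C" and D: "closed_pointed_cone d D"
    and lifts: "\<And>u X. u \<in> J \<Longrightarrow> X \<in> C \<Longrightarrow> lift_mat u X \<in> D"
  shows "closed_pointed_cone d (higher_order_cone d C J)"
proof -
  let ?H = "higher_order_cone d C J"
  note C' = closed_pointed_coneD[OF C] and D' = closed_pointed_coneD[OF D]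
  have cone: "convex_cone ?H" by (rule convex_cone_higher_order_cone[OF J C'(1,2)])
  have "closed C"
    using C closed_hermitian closedin_closed_trans unfolding closed_pointed_cone_def by blast
  hence "closed ?H"
    using closed_higher_order_cone[OF J C'(1,2) _ D'(2,3) lifts] by blast
  moreover have herm: "?H \<subseteq> hermitian d" by (auto simp: higher_order_cone_def)
  moreover have "?H \<subseteq> D"
    using D'(2) lifts by (auto intro: higher_order_cone_minimal simp: convex_cone_iff)
  hence "?H \<inter> uminus ` ?H \<subseteq> {0}" using D'(3) by fastforce
  moreover have "0 \<in> ?H \<inter> uminus ` ?H"
    using cone image_eqI[of 0 uminus 0 ?H] by (simp add: convex_cone_iff)
  moreover have "convex ?H \<and> cone ?H"
    using cone unfolding convex_cone by (simp add: convex_cone_iff)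
  ultimately show ?thesis
    by (auto simp: closed_pointed_cone_def pointed_def closedin_closed_eq[OF closed_hermitian])
qed

lemma higher_order_cone_full:
  assumes "C \<subseteq> hermitian k" "convex_cone C"
  shows "higher_order_cone k C (incr_seqs k k) = C"
proof -
  have lift: "lift_mat [0..<k] X = X" if "X \<in> C" for X
    by (rule lift_mat_eqI) (use that assms(1) hermitian_outside[of X k] in auto)
  have "M \<in> higher_order_cone k C (incr_seqs k k) \<longleftrightarrow> (\<exists>X. X \<in> C \<and> M = X)" for M
    unfolding higher_order_cone_iff[OF order_refl assms] by (auto simp: incr_seqs_full lift)
  thus ?thesis by blast
qed

theorem proposition2p3:
  fixes K :: "nat \<Rightarrow> ('a::hurwitz_algebra) sqmat set"
    and I :: "nat \<Rightarrow> nat \<Rightarrow> nat list set"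
    and k0 :: nat
  assumes k0: "1 \<le> k0"
    and proper: "\<And>k. k0 \<le> k \<Longrightarrow> proper_cone k (K k)"
    and index_map: "\<And>d k. k0 \<le> k \<Longrightarrow> k \<le> d \<Longrightarrow> I d k \<subseteq> incr_seqs d k"
    and embedding: "embedding_property k0 I K"
  shows
    "\<comment> \<open>(i) nested cones\<close>
     ((\<forall>d J. k0 \<le> d \<and> (\<forall>k. k0 \<le> k \<and> k \<le> d \<longrightarrow> J k \<subseteq> I d k) \<and> nested_index_sets k0 d J \<longrightarrow>
        (\<forall>k. k0 \<le> k \<and> k < d \<longrightarrow>
          higher_order_cone d (K k) (J k) \<subseteq> higher_order_cone d (K (Suc k)) (J (Suc k))))
     \<and> (\<forall>d\<ge>k0. nested_index_sets k0 d (incr_seqs d))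
     \<and> (\<forall>d\<ge>k0. nested_index_sets k0 d (I d) \<longrightarrow>
        (\<forall>k. k0 \<le> k \<and> k < d \<longrightarrow>
          higher_order_cone d (K k) (I d k) \<subseteq> higher_order_cone d (K (Suc k)) (I d (Suc k)))))
     \<and> \<comment> \<open>(ii) dual cones\<close>
     (\<forall>d k J. k0 \<le> k \<and> k \<le> d \<and> J \<subseteq> I d k \<longrightarrow>
        dual_cone d (higher_order_cone d (K k) J) =
          {A \<in> hermitian d. \<forall>is\<in>J. truncation is A \<in> dual_cone k (K k)})
     \<and> \<comment> \<open>(iii) membership\<close>
     (\<forall>k t s X1 X2.
        k0 \<le> k \<and> k \<le> t \<and> k \<le> s \<and> (\<forall>d\<ge>k. I d k = incr_seqs d k) \<and>
        X1 \<in> hermitian t \<and> X2 \<in> hermitian s \<longrightarrow>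
        (X1 \<in> higher_order_cone t (K k) (I t k) \<and> X2 \<in> higher_order_cone s (K k) (I s k) \<longleftrightarrow>
          block_diag t s X1 X2 \<in> higher_order_cone (t + s) (K k) (I (t + s) k)) \<and>
        (X1 \<in> dual_cone t (higher_order_cone t (K k) (I t k)) \<and>
         X2 \<in> dual_cone s (higher_order_cone s (K k) (I s k)) \<longleftrightarrow>
          block_diag t s X1 X2 \<in>
            dual_cone (t + s) (higher_order_cone (t + s) (K k) (I (t + s) k))))
     \<and> \<comment> \<open>(iv) inheritance\<close>
     (k0 = 1 \<and> embedding_property_thoroughly K \<longrightarrow>
        (\<forall>k\<ge>1.
          embedding_property k incr_seqs (\<lambda>l. higher_order_cone l (K k) (incr_seqs l k)) \<and>
          (\<forall>l\<ge>k.
            closed_pointed_cone l (higher_order_cone l (K k) (incr_seqs l k)) \<and>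
            (2 \<le> k \<or> l = k \<longrightarrow>
              proper_cone l (higher_order_cone l (K k) (incr_seqs l k))))))"
proof -
  have closed_pointed: "closed_pointed_cone k (K k)" if "k0 \<le> k" for k
    using proper[OF that] by (simp add: proper_cone_def)
  have K: "K k \<subseteq> hermitian k" "convex_cone (K k)" if "k0 \<le> k" for k
    using closed_pointed_coneD[OF closed_pointed[OF that]] by blast+
  have trunc: "truncation u Z \<in> K k"
    if "k0 \<le> k" "k \<le> d" "u \<in> I d k" "Z \<in> K d" for d k u Z
    using embedding that unfolding embedding_property_def by blast
  have lift: "lift_mat u X \<in> K d"
    if "k0 \<le> k" "k \<le> d" "u \<in> I d k" "X \<in> K k" for d k u X
    using embedding that unfolding embedding_property_def by blast
  have nested: "higher_order_cone d (K k) (J k) \<subseteq> higher_order_cone d (K (Suc k)) (J (Suc k))"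
    if J: "\<forall>k. k0 \<le> k \<and> k \<le> d \<longrightarrow> J k \<subseteq> I d k" "nested_index_sets k0 d J"
      and k: "k0 \<le> k" "k < d" for d J k
  proof (rule higher_order_cone_nested)
    show "J k \<subseteq> incr_seqs d k" "J (Suc k) \<subseteq> incr_seqs d (Suc k)"
      using J(1)[rule_format, of k] J(1)[rule_format, of "Suc k"] index_map[of k d] index_map[of "Suc k" d] k by auto
    show "K (Suc k) \<subseteq> hermitian (Suc k)" "convex_cone (K (Suc k))"
      using K[of "Suc k"] k by auto
    show "\<exists>u'\<in>J (Suc k). set u \<subseteq> set u'" if "u \<in> J k" for u
      using J(2) k that unfolding nested_index_sets_def by blast
    \<comment> \<open>The embedding property is used at \<open>(d, k)\<close> and at \<open>(d, Suc k)\<close>; nothing is known about the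
      index sequences in \<open>I (Suc k) k\<close>.\<close>
    show "truncation u' (lift_mat u X) \<in> K (Suc k)"
      if u: "u \<in> J k" "u' \<in> J (Suc k)" "X \<in> K k" for u u' X
    proof (rule trunc[of _ d])
      show "lift_mat u X \<in> K d" by (rule lift[of k]) (use u J(1)[rule_format, of k] k in auto)
    qed (use u J(1)[rule_format, of "Suc k"] k in auto)
  qed
  have dual: "dual_cone d (higher_order_cone d (K k) J) =
      {A \<in> hermitian d. \<forall>u\<in>J. truncation u A \<in> dual_cone k (K k)}"
    if "k0 \<le> k" "k \<le> d" "J \<subseteq> I d k" for d k J
    by (rule dual_higher_order_cone) (use that K index_map in blast)+
  have membership:
    "(X1 \<in> higher_order_cone t (K k) (I t k) \<and> X2 \<in> higher_order_cone s (K k) (I s k) \<longleftrightarrow>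
        block_diag t s X1 X2 \<in> higher_order_cone (t + s) (K k) (I (t + s) k)) \<and>
      (X1 \<in> dual_cone t (higher_order_cone t (K k) (I t k)) \<and>
       X2 \<in> dual_cone s (higher_order_cone s (K k) (I s k)) \<longleftrightarrow>
        block_diag t s X1 X2 \<in>
          dual_cone (t + s) (higher_order_cone (t + s) (K k) (I (t + s) k)))"
    if k: "k0 \<le> k" "k \<le> t" "k \<le> s" and I: "\<forall>d\<ge>k. I d k = incr_seqs d k"
      and X: "X1 \<in> hermitian t" "X2 \<in> hermitian s" for k t s X1 X2
  proof -
    have I': "I t k = incr_seqs t k" "I s k = incr_seqs s k" "I (t + s) k = incr_seqs (t + s) k"
      using I k by auto
    have stable: "truncation w (lift_mat v X) \<in> K k"
      if "v \<in> incr_seqs (t + s) k" "w \<in> incr_seqs (t + s) k" "X \<in> K k" for v w X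
      using that k trunc[of k "t + s" w "lift_mat v X"] lift[of k "t + s" v X] I'(3) by simp
    show ?thesis
      unfolding I'
      using block_diag_in_higher_order_cone_iff[OF K[OF k(1)] stable k(2,3) X]
        block_diag_in_dual_iff[OF K[OF k(1)] stable k(2,3) X]
      by simp
  qed
  have inheritance:
    "embedding_property k incr_seqs (\<lambda>l. higher_order_cone l (K k) (incr_seqs l k)) \<and>
      (\<forall>l\<ge>k. closed_pointed_cone l (higher_order_cone l (K k) (incr_seqs l k)) \<and>
        (2 \<le> k \<or> l = k \<longrightarrow> proper_cone l (higher_order_cone l (K k) (incr_seqs l k))))"
    if "k0 = 1" and thorough: "embedding_property_thoroughly K" and k: "1 \<le> k" for k
  proof -
    note Kk = K[of k, unfolded \<open>k0 = 1\<close>, OF k]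
    let ?H = "\<lambda>l. higher_order_cone l (K k) (incr_seqs l k)"
    have trunc: "truncation u Z \<in> K k" if "k \<le> d" "u \<in> incr_seqs d k" "Z \<in> K d" for d u Z
      using thorough that k unfolding embedding_property_thoroughly_def embedding_property_def
      by blast
    have lift: "lift_mat u X \<in> K d" if "k \<le> d" "u \<in> incr_seqs d k" "X \<in> K k" for d u X
      using thorough that k unfolding embedding_property_thoroughly_def embedding_property_def
      by blast
    have "truncation u Z \<in> ?H m" if "k \<le> m" "m \<le> d" "u \<in> incr_seqs d m" "Z \<in> ?H d" for d m u Z
    proof (rule truncation_higher_order_cone[OF that(3,1) Kk _ that(4)])
      show "truncation w (lift_mat v X) \<in> K k"
        if "v \<in> incr_seqs d k" "w \<in> incr_seqs d k" "X \<in> K k" for v w X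
        using trunc[OF _ that(2) lift[OF _ that(1,3)]] \<open>k \<le> m\<close> \<open>m \<le> d\<close> by simp
    qed
    moreover have "lift_mat u X \<in> ?H d" if "u \<in> incr_seqs d m" "X \<in> ?H m" for d m u X
      by (rule lift_higher_order_cone[OF that(1) Kk that(2)])
    ultimately have "embedding_property k incr_seqs ?H"
      unfolding embedding_property_def by blast
    moreover have cp: "closed_pointed_cone l (?H l)" if "k \<le> l" for l
      by (rule closed_pointed_higher_order_cone[where D = "K l", OF order_refl])
         (use that k lift closed_pointed \<open>k0 = 1\<close> in auto)
    moreover have "proper_cone l (?H l)" if l: "k \<le> l" and "2 \<le> k \<or> l = k" for l
      using that(2)
    proof
      assume "2 \<le> k"
      have "solid k (K k)" using proper[of k] k \<open>k0 = 1\<close> by (simp add: proper_cone_def)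
      thus ?thesis
        using solid_higher_order_cone[OF \<open>2 \<le> k\<close> l Kk] cp[OF l] by (simp add: proper_cone_def)
    next
      assume "l = k"
      thus ?thesis using higher_order_cone_full[OF Kk] proper[of k] k \<open>k0 = 1\<close> by simp
    qed
    ultimately show ?thesis by blast
  qed
  have nested_all: "higher_order_cone d (K k) (I d k) \<subseteq> higher_order_cone d (K (Suc k)) (I d (Suc k))"
    if "nested_index_sets k0 d (I d)" "k0 \<le> k" "k < d" for d k
    using nested[of d "I d"] that by simp
  show ?thesis
    by (intro conjI; intro allI impI; (elim conjE)?)
       ((rule nested; assumption), rule nested_index_sets_incr_seqs, (rule nested_all; assumption),
        (rule dual; assumption), (rule membership; assumption), (rule inheritance; assumption))
qed

end
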